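(* Let $Q$ be a closed polyhedral partially ordered group, $M$ a $Q$-module, and $\tau$ a face of the positive cone $Q_+$. The module $M$ is $\tau$-coprimary if and only if every nonzero homogeneous element of $M$ divides a $\tau$-coprimary element, where $y\in M_q$ divides $y'\in M_{q'}$ if $q\preceq q'$ and $y$ has image $y'$ under the structure morphism $M_q\to M_{q'}$.
   Context: Fix a field $\Bbbk$. A partially ordered group is an abelian group $Q$ generated by a submonoid $Q_+$ (the positive cone) with trivial unit group, ordered by $q\preceq q'\iff q'-q\in Q_+$. A face of $Q_+$ is a submonoid $\sigma\subseteq Q_+$ such that $Q_+\smallsetminus\sigma$ is an ideal of the monoid $Q_+$; $Q$ is polyhedral if it has only finitely many faces. A ray of $Q_+$ is a face that is totally ordered as a partially ordered submonoid of $Q$. $Q$ is closed if for each face $\tau$ the complement $Q_+\smallsetminus\tau$ is generated as an upset (i.e. as an ideal) of $Q_+$ by the sets $\rho\smallsetminus\{0\}$ for the rays $\rho\not\subseteq\tau$. A $Q$-module is a $Q$-graded $\Bbbk$-vector space $M=\bigoplus_{q\in Q}M_q$ with functorial structure morphisms $M_q\to M_{q'}$ for $q\preceq q'$; equivalently, a $Q$-graded module over the monoid algebra $\Bbbk[Q_+]$. The localization of $M$ along $\tau$ is $M_\tau=M\otimes_{\Bbbk[Q_+]}\Bbbk[Q_++\mathbb Z\tau]$, where $\mathbb Z\tau$ is the subgroup generated by $\tau$. The submodule globally supported on $\tau$ is $\Gamma_\tau M=\bigcap_{\tau'\not\subseteq\tau}\ker(M\to M_{\tau'})$, over faces $\tau'$.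 $M$ is $\tau$-coprimary if the localization map $M\to M_\tau$ is injective and $\Gamma_\tau M_\tau$ is an essential submodule of $M_\tau$: every nonzero ($Q$-graded) submodule of $M_\tau$ intersects $\Gamma_\tau M_\tau$ nontrivially. A homogeneous element $y\in M_q$ is: $\tau$-persistent if it has nonzero image in $M_{q'}$ for all $q'\in q+\tau$; $\overline\tau$-transient if for each $f\in Q_+\smallsetminus\tau$ the image of $y$ vanishes in $M_{q'}$ whenever $q'=q+\lambda f$ for $\lambda\gg0$; $\tau$-coprimary if it is both $\tau$-persistent and $\overline\tau$-transient. *)

theory Defs
  imports "HOL-Algebra.Module" "HOL-Algebra.AbelCoset" "HOL.Hull"
begin

section \<open>Partially ordered groups and their faces\<close>

definition add_submonoid :: "'q::ab_group_add set \<Rightarrow> bool" where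
  "add_submonoid S \<longleftrightarrow> 0 \<in> S \<and> (\<forall>x\<in>S. \<forall>y\<in>S. x + y \<in> S)"

definition add_subgroup :: "'q::ab_group_add set \<Rightarrow> bool" where
  "add_subgroup H \<longleftrightarrow> add_submonoid H \<and> (\<forall>x\<in>H. - x \<in> H)"

text \<open>The group \<open>Q\<close> is a type; the partial order is given by its positive cone \<open>Qp\<close>.\<close>

definition partially_ordered_group :: "'q::ab_group_add set \<Rightarrow> bool" where
  "partially_ordered_group Qp \<longleftrightarrow>
     add_submonoid Qp \<and> add_subgroup hull Qp = UNIV \<and> (\<forall>x\<in>Qp. - x \<in> Qp \<longrightarrow> x = 0)"

definition qle :: "'q::ab_group_add set \<Rightarrow> 'q \<Rightarrow> 'q \<Rightarrow> bool" where
  "qle Qp q q' \<longleftrightarrow> q' - q \<in> Qp"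

text \<open>Ideals may be empty, so that \<open>Qp\<close> is a face of itself.\<close>

definition monoid_ideal :: "'q::ab_group_add set \<Rightarrow> 'q set \<Rightarrow> bool" where
  "monoid_ideal Qp I \<longleftrightarrow> I \<subseteq> Qp \<and> (\<forall>x\<in>I. \<forall>p\<in>Qp. x + p \<in> I)"

definition face :: "'q::ab_group_add set \<Rightarrow> 'q set \<Rightarrow> bool" where
  "face Qp \<sigma> \<longleftrightarrow> add_submonoid \<sigma> \<and> \<sigma> \<subseteq> Qp \<and> monoid_ideal Qp (Qp - \<sigma>)"

definition polyhedral :: "'q::ab_group_add set \<Rightarrow> bool" where
  "polyhedral Qp \<longleftrightarrow> finite {\<sigma>. face Qp \<sigma>}"

definition ray :: "'q::ab_group_add set \<Rightarrow> 'q set \<Rightarrow> bool" where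
  "ray Qp \<rho> \<longleftrightarrow> face Qp \<rho> \<and> (\<forall>x\<in>\<rho>. \<forall>y\<in>\<rho>. qle Qp x y \<or> qle Qp y x)"

definition closed_pogroup :: "'q::ab_group_add set \<Rightarrow> bool" where
  "closed_pogroup Qp \<longleftrightarrow>
     (\<forall>\<tau>. face Qp \<tau> \<longrightarrow>
        Qp - \<tau> = monoid_ideal Qp hull (\<Union>\<rho>\<in>{\<rho>. ray Qp \<rho> \<and> \<not> \<rho> \<subseteq> \<tau>}. \<rho> - {0}))"

section \<open>Graded modules\<close>

text \<open>
  The \<open>q\<close>-graded component of \<open>M\<close> is \<open>part M q\<close>, a vector space over the field \<open>K\<close>,
  and \<open>smap M q q'\<close> is the structure morphism from degree \<open>q\<close> to degree \<open>q'\<close>.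
  It is only meaningful on the carrier of \<open>part M q\<close> and for \<open>qle Qp q q'\<close>, when it is
  multiplication by the monomial of degree \<open>q' - q\<close>.
  (The ring multiplication and unit fields of the library's module records are irrelevant.)
\<close>

record ('q, 'k, 'v) qmod =
  part :: "'q \<Rightarrow> ('k, 'v) module"
  smap :: "'q \<Rightarrow> 'q \<Rightarrow> 'v \<Rightarrow> 'v"

definition linear_maps :: "'k ring \<Rightarrow> ('k, 'v) module \<Rightarrow> ('k, 'w) module \<Rightarrow> ('v \<Rightarrow> 'w) set" where
  "linear_maps K V W =
     {h \<in> carrier V \<rightarrow> carrier W.
        (\<forall>x\<in>carrier V. \<forall>y\<in>carrier V. h (x \<oplus>\<^bsub>V\<^esub> y) = h x \<oplus>\<^bsub>W\<^esub> h y) \<and>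
        (\<forall>c\<in>carrier K. \<forall>x\<in>carrier V. h (c \<odot>\<^bsub>V\<^esub> x) = c \<odot>\<^bsub>W\<^esub> h x)}"

definition is_qmodule ::
  "'k ring \<Rightarrow> 'q::ab_group_add set \<Rightarrow> ('q, 'k, 'v) qmod \<Rightarrow> bool" where
  "is_qmodule K Qp M \<longleftrightarrow>
     (\<forall>q. module K (part M q)) \<and>
     (\<forall>q q'. qle Qp q q' \<longrightarrow> smap M q q' \<in> linear_maps K (part M q) (part M q')) \<and>
     (\<forall>q. \<forall>x\<in>carrier (part M q). smap M q q x = x) \<and>
     (\<forall>q q' q''. qle Qp q q' \<longrightarrow> qle Qp q' q'' \<longrightarrow>
        (\<forall>x\<in>carrier (part M q). smap M q' q'' (smap M q q' x) = smap M q q'' x))"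

text \<open>A graded submodule is the family of its graded components.\<close>

definition is_qsubmodule ::
  "'k ring \<Rightarrow> 'q::ab_group_add set \<Rightarrow> ('q, 'k, 'v) qmod \<Rightarrow> ('q \<Rightarrow> 'v set) \<Rightarrow> bool" where
  "is_qsubmodule K Qp M N \<longleftrightarrow>
     (\<forall>q. submodule (N q) K (part M q)) \<and>
     (\<forall>q q'. qle Qp q q' \<longrightarrow> smap M q q' \<in> N q \<rightarrow> N q')"

definition essential_qsubmodule ::
  "'k ring \<Rightarrow> 'q::ab_group_add set \<Rightarrow> ('q, 'k, 'v) qmod \<Rightarrow> ('q \<Rightarrow> 'v set) \<Rightarrow> bool" where
  "essential_qsubmodule K Qp M G \<longleftrightarrow>
     is_qsubmodule K Qp M G \<and>
     (\<forall>N. is_qsubmodule K Qp M N \<and> (\<exists>q. N q \<noteq> {\<zero>\<^bsub>part M q\<^esub>}) \<longrightarrow>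
        (\<exists>q. N q \<inter> G q \<noteq> {\<zero>\<^bsub>part M q\<^esub>}))"

section \<open>Free modules, quotients and graded tensor products\<close>

definition free_module :: "'k ring \<Rightarrow> 's set \<Rightarrow> ('k, 's \<Rightarrow> 'k) module" where
  "free_module K S =
     \<lparr> carrier = {f. f \<in> S \<rightarrow> carrier K \<and> (\<forall>s. s \<notin> S \<longrightarrow> f s = \<zero>\<^bsub>K\<^esub>) \<and> finite {s. f s \<noteq> \<zero>\<^bsub>K\<^esub>}},
       mult = undefined, one = undefined,
       zero = (\<lambda>_. \<zero>\<^bsub>K\<^esub>), add = (\<lambda>f g s. f s \<oplus>\<^bsub>K\<^esub> g s),
       smult = (\<lambda>c f s. c \<otimes>\<^bsub>K\<^esub> f s) \<rparr>"

definition basis_elt :: "'k ring \<Rightarrow> 's \<Rightarrow> ('s \<Rightarrow> 'k)" where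
  "basis_elt K s = (\<lambda>t. if t = s then \<one>\<^bsub>K\<^esub> else \<zero>\<^bsub>K\<^esub>)"

text \<open>The linear map into the free module \<open>F\<close> that sends each basis element \<open>s\<close> to \<open>g s\<close>.\<close>

definition free_map :: "'k ring \<Rightarrow> ('k, 't \<Rightarrow> 'k) module \<Rightarrow> ('s \<Rightarrow> 't) \<Rightarrow> ('s \<Rightarrow> 'k) \<Rightarrow> ('t \<Rightarrow> 'k)" where
  "free_map K F g f = (\<Oplus>\<^bsub>F\<^esub>s\<in>{s. f s \<noteq> \<zero>\<^bsub>K\<^esub>}. f s \<odot>\<^bsub>F\<^esub> basis_elt K (g s))"

definition quot_module :: "('k, 'v) module \<Rightarrow> 'v set \<Rightarrow> ('k, 'v set) module" where
  "quot_module V N =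
     \<lparr> carrier = a_rcosets\<^bsub>V\<^esub> N, mult = undefined, one = undefined,
       zero = N, add = (<+>\<^bsub>V\<^esub>),
       smult = (\<lambda>c X. \<Union>x\<in>X. N +>\<^bsub>V\<^esub> (c \<odot>\<^bsub>V\<^esub> x)) \<rparr>"

text \<open>
  The tensor product of two \<open>Q\<close>-modules over the monoid algebra of \<open>Qp\<close>.  In degree \<open>q\<close> it is
  generated over \<open>K\<close> by the symbols \<open>((a, m), (b, n))\<close>, standing for the tensor of a homogeneous
  \<open>m\<close> of degree \<open>a\<close> and a homogeneous \<open>n\<close> of degree \<open>b\<close> with \<open>a + b = q\<close>, subject to
  bilinearity over \<open>K\<close> and to balancedness over the monoid algebra (enough on monomials,
  i.e. on the degrees \<open>p \<in> Qp\<close>, since these span it).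
\<close>

type_synonym ('q, 'v, 'w) tsym = "('q \<times> 'v) \<times> ('q \<times> 'w)"

definition tensor_syms ::
  "('q::ab_group_add, 'k, 'v) qmod \<Rightarrow> ('q, 'k, 'w) qmod \<Rightarrow> 'q \<Rightarrow> ('q, 'v, 'w) tsym set" where
  "tensor_syms M N q =
     {((a, m), (b, n)) | a m b n. a + b = q \<and> m \<in> carrier (part M a) \<and> n \<in> carrier (part N b)}"

abbreviation tensor_free ::
  "'k ring \<Rightarrow> ('q::ab_group_add, 'k, 'v) qmod \<Rightarrow> ('q, 'k, 'w) qmod \<Rightarrow> 'q \<Rightarrow>
     ('k, ('q, 'v, 'w) tsym \<Rightarrow> 'k) module" where
  "tensor_free K M N q \<equiv> free_module K (tensor_syms M N q)"

definition tensor_rels ::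
  "'k ring \<Rightarrow> 'q::ab_group_add set \<Rightarrow> ('q, 'k, 'v) qmod \<Rightarrow> ('q, 'k, 'w) qmod \<Rightarrow> 'q \<Rightarrow>
     (('q, 'v, 'w) tsym \<Rightarrow> 'k) set" where
  "tensor_rels K Qp M N q =
     (let F = tensor_free K M N q; e = (\<lambda>a m b n. basis_elt K ((a, m), (b, n))) in
       {e a (m \<oplus>\<^bsub>part M a\<^esub> m') b n \<ominus>\<^bsub>F\<^esub> (e a m b n \<oplus>\<^bsub>F\<^esub> e a m' b n) | a m m' b n.
          a + b = q \<and> m \<in> carrier (part M a) \<and> m' \<in> carrier (part M a) \<and> n \<in> carrier (part N b)}
     \<union> {e a m b (n \<oplus>\<^bsub>part N b\<^esub> n') \<ominus>\<^bsub>F\<^esub> (e a m b n \<oplus>\<^bsub>F\<^esub> e a m b n') | a m b n n'.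
          a + b = q \<and> m \<in> carrier (part M a) \<and> n \<in> carrier (part N b) \<and> n' \<in> carrier (part N b)}
     \<union> {e a (c \<odot>\<^bsub>part M a\<^esub> m) b n \<ominus>\<^bsub>F\<^esub> c \<odot>\<^bsub>F\<^esub> e a m b n | a m b n c.
          a + b = q \<and> c \<in> carrier K \<and> m \<in> carrier (part M a) \<and> n \<in> carrier (part N b)}
     \<union> {e a m b (c \<odot>\<^bsub>part N b\<^esub> n) \<ominus>\<^bsub>F\<^esub> c \<odot>\<^bsub>F\<^esub> e a m b n | a m b n c.
          a + b = q \<and> c \<in> carrier K \<and> m \<in> carrier (part M a) \<and> n \<in> carrier (part N b)}
     \<union> {e (a + p) (smap M a (a + p) m) b n \<ominus>\<^bsub>F\<^esub> e a m (b + p) (smap N b (b + p) n) | a m b n p.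
          a + p + b = q \<and> p \<in> Qp \<and> m \<in> carrier (part M a) \<and> n \<in> carrier (part N b)})"

definition tensor_null ::
  "'k ring \<Rightarrow> 'q::ab_group_add set \<Rightarrow> ('q, 'k, 'v) qmod \<Rightarrow> ('q, 'k, 'w) qmod \<Rightarrow> 'q \<Rightarrow>
     (('q, 'v, 'w) tsym \<Rightarrow> 'k) set" where
  "tensor_null K Qp M N q =
     (\<lambda>H. submodule H K (tensor_free K M N q)) hull tensor_rels K Qp M N q"

definition tensor_class ::
  "'k ring \<Rightarrow> 'q::ab_group_add set \<Rightarrow> ('q, 'k, 'v) qmod \<Rightarrow> ('q, 'k, 'w) qmod \<Rightarrow> 'q \<Rightarrow>
     (('q, 'v, 'w) tsym \<Rightarrow> 'k) \<Rightarrow> (('q, 'v, 'w) tsym \<Rightarrow> 'k) set" where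
  "tensor_class K Qp M N q f = tensor_null K Qp M N q +>\<^bsub>tensor_free K M N q\<^esub> f"

text \<open>
  A monomial acts on the second tensor factor.  The structure map takes the union of the classes
  of the images of all representatives; these classes coincide.
\<close>

definition tensor_shift ::
  "('q::ab_group_add, 'k, 'w) qmod \<Rightarrow> 'q \<Rightarrow> ('q, 'v, 'w) tsym \<Rightarrow> ('q, 'v, 'w) tsym" where
  "tensor_shift N p = (\<lambda>((a, m), (b, n)). ((a, m), (b + p, smap N b (b + p) n)))"

definition tensor_qmod ::
  "'k ring \<Rightarrow> 'q::ab_group_add set \<Rightarrow> ('q, 'k, 'v) qmod \<Rightarrow> ('q, 'k, 'w) qmod \<Rightarrow>
     ('q, 'k, (('q, 'v, 'w) tsym \<Rightarrow> 'k) set) qmod" where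
  "tensor_qmod K Qp M N =
     \<lparr> part = (\<lambda>q. quot_module (tensor_free K M N q) (tensor_null K Qp M N q)),
       smap = (\<lambda>q q' X. \<Union>f\<in>X. tensor_class K Qp M N q'
                 (free_map K (tensor_free K M N q') (tensor_shift N (q' - q)) f)) \<rparr>"

section \<open>Localization and coprimary modules\<close>

text \<open>
  The monoid algebra of \<open>B\<close>, for \<open>B + Qp \<subseteq> B\<close>, as a \<open>Q\<close>-module: in degree \<open>b \<in> B\<close> it consists
  of the multiples of the monomial of degree \<open>b\<close>, represented by their coefficients, and in all
  other degrees it is zero.  Multiplication by a monomial preserves coefficients.
\<close>

definition monoid_algebra :: "'k ring \<Rightarrow> 'q::ab_group_add set \<Rightarrow> ('q, 'k, 'k) qmod" where
  "monoid_algebra K B =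
     \<lparr> part = (\<lambda>b. \<lparr> carrier = (if b \<in> B then carrier K else {\<zero>\<^bsub>K\<^esub>}),
                      mult = undefined, one = undefined,
                      zero = \<zero>\<^bsub>K\<^esub>, add = add K, smult = mult K \<rparr>),
       smap = (\<lambda>b b' c. c) \<rparr>"

definition loc_cone :: "'q::ab_group_add set \<Rightarrow> 'q set \<Rightarrow> 'q set" where
  "loc_cone Qp \<tau> = {p + z | p z. p \<in> Qp \<and> z \<in> add_subgroup hull \<tau>}"

definition localization ::
  "'k ring \<Rightarrow> 'q::ab_group_add set \<Rightarrow> 'q set \<Rightarrow> ('q, 'k, 'v) qmod \<Rightarrow>
     ('q, 'k, (('q, 'v, 'k) tsym \<Rightarrow> 'k) set) qmod" where
  "localization K Qp \<tau> M = tensor_qmod K Qp M (monoid_algebra K (loc_cone Qp \<tau>))"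

definition loc_map ::
  "'k ring \<Rightarrow> 'q::ab_group_add set \<Rightarrow> 'q set \<Rightarrow> ('q, 'k, 'v) qmod \<Rightarrow> 'q \<Rightarrow> 'v \<Rightarrow>
     (('q, 'v, 'k) tsym \<Rightarrow> 'k) set" where
  "loc_map K Qp \<tau> M q m =
     tensor_class K Qp M (monoid_algebra K (loc_cone Qp \<tau>)) q (basis_elt K ((q, m), (0, \<one>\<^bsub>K\<^esub>)))"

definition global_support ::
  "'k ring \<Rightarrow> 'q::ab_group_add set \<Rightarrow> 'q set \<Rightarrow> ('q, 'k, 'v) qmod \<Rightarrow> 'q \<Rightarrow> 'v set" where
  "global_support K Qp \<tau> M q =
     {m \<in> carrier (part M q). \<forall>\<tau>'. face Qp \<tau>' \<and> \<not> \<tau>' \<subseteq> \<tau> \<longrightarrow>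
        loc_map K Qp \<tau>' M q m = \<zero>\<^bsub>part (localization K Qp \<tau>' M) q\<^esub>}"

definition coprimary_module ::
  "'k ring \<Rightarrow> 'q::ab_group_add set \<Rightarrow> 'q set \<Rightarrow> ('q, 'k, 'v) qmod \<Rightarrow> bool" where
  "coprimary_module K Qp \<tau> M \<longleftrightarrow>
     (\<forall>q. inj_on (loc_map K Qp \<tau> M q) (carrier (part M q))) \<and>
     essential_qsubmodule K Qp (localization K Qp \<tau> M)
       (global_support K Qp \<tau> (localization K Qp \<tau> M))"

section \<open>Coprimary elements\<close>

definition persistent ::
  "'q::ab_group_add set \<Rightarrow> ('q, 'k, 'v) qmod \<Rightarrow> 'q \<Rightarrow> 'v \<Rightarrow> bool" where
  "persistent \<tau> M q y \<longleftrightarrow> (\<forall>t\<in>\<tau>. smap M q (q + t) y \<noteq> \<zero>\<^bsub>part M (q + t)\<^esub>)"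

definition transient ::
  "'q::ab_group_add set \<Rightarrow> 'q set \<Rightarrow> ('q, 'k, 'v) qmod \<Rightarrow> 'q \<Rightarrow> 'v \<Rightarrow> bool" where
  "transient Qp \<tau> M q y \<longleftrightarrow>
     (\<forall>f\<in>Qp - \<tau>. \<exists>l0::nat. \<forall>l\<ge>l0.
        let q' = q + (\<Sum>i<l. f) in smap M q q' y = \<zero>\<^bsub>part M q'\<^esub>)"

definition coprimary_element ::
  "'q::ab_group_add set \<Rightarrow> 'q set \<Rightarrow> ('q, 'k, 'v) qmod \<Rightarrow> 'q \<Rightarrow> 'v \<Rightarrow> bool" where
  "coprimary_element Qp \<tau> M q y \<longleftrightarrow>
     y \<in> carrier (part M q) \<and> persistent \<tau> M q y \<and> transient Qp \<tau> M q y"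

definition divides ::
  "'q::ab_group_add set \<Rightarrow> ('q, 'k, 'v) qmod \<Rightarrow> 'q \<Rightarrow> 'v \<Rightarrow> 'q \<Rightarrow> 'v \<Rightarrow> bool" where
  "divides Qp M q y q' y' \<longleftrightarrow> qle Qp q q' \<and> smap M q q' y = y'"

end

theory Submission
  imports Defs
begin

text \<open>
  Everything rests on an elementary description of the localization \<open>M\<^sub>\<tau>\<close>: it is the direct limit of
  the components \<open>M\<^bsub>q + t\<^esub>\<close> over \<open>t \<in> \<tau>\<close>.  Concretely, \<open>\<lambda> : M \<rightarrow> M\<^sub>\<tau>\<close> kills \<open>m\<close> exactly when some
  \<open>t \<in> \<tau>\<close> does (\<open>loc_map_zero_iff\<close>), every element of \<open>M\<^sub>\<tau>\<close> is carried into the image of \<open>\<lambda>\<close> by some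
  \<open>t \<in> \<tau>\<close> (\<open>L_clear_denominator\<close>), and the \<open>t \<in> \<tau>\<close> act injectively on \<open>M\<^sub>\<tau>\<close> (\<open>smap_L_inj_along\<close>).
  To get this from the presentation of the tensor product by generators and relations, evaluate a
  formal combination of tensors \<open>m \<otimes> x\<^sup>b\<close> of total degree \<open>q\<close> in \<open>M\<^bsub>q + t\<^esub>\<close>, by letting \<open>b + t\<close> act
  on \<open>m\<close> as soon as it lies in the positive cone.  All relations evaluate to zero for \<open>t\<close> far enough
  out in \<open>\<tau>\<close>; conversely a combination with eventual value \<open>v\<close> at \<open>t\<close> is congruent to the single
  tensor \<open>v \<otimes> x\<^bsup>-t\<^esup>\<close>.  So the classes are the eventual values (\<open>cls_eq_germ_val\<close>, \<open>cls_zero_iff\<close>).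

  Given this, injectivity of \<open>\<lambda>\<close> says that all nonzero elements of \<open>M\<close> are persistent along \<open>\<tau>\<close>, and an
  element of a module is globally supported on \<open>\<tau>\<close> iff every face \<open>\<tau>' \<not>\<subseteq> \<tau>\<close> contains a degree that kills it.

  If \<open>M\<close> is coprimary and \<open>y \<noteq> 0\<close>, essentiality applied to the submodule generated by \<open>\<lambda> y\<close> yields a nonzero
  multiple \<open>\<lambda> y'\<close> in the global support, where \<open>y\<close> divides \<open>y'\<close>.  This \<open>y'\<close> is persistent.  For transience
  along \<open>f \<in> Q\<^sub>+ - \<tau>\<close>, use the face of all \<open>x\<close> that lie below some multiple of \<open>f\<close>: it contains \<open>f\<close>, hence
  is not inside \<open>\<tau>\<close>, hence contains a degree that kills \<open>y'\<close>; a multiple of \<open>f\<close> above that degree kills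
  \<open>y'\<close> as well.

  Conversely, suppose that nonzero elements divide coprimary ones.  What divides a persistent element is
  persistent, so \<open>\<lambda>\<close> is injective.  A nonzero submodule of \<open>M\<^sub>\<tau>\<close> contains some \<open>\<lambda> m \<noteq> 0\<close>, after clearing
  denominators, hence also \<open>\<lambda> y\<close> for a coprimary \<open>y\<close> that \<open>m\<close> divides.  It is nonzero as \<open>y\<close> is
  persistent, and it is globally supported on \<open>\<tau>\<close>: a face \<open>\<tau>' \<not>\<subseteq> \<tau>\<close> contains some \<open>f \<notin> \<tau>\<close>, and transience
  makes a multiple of \<open>f\<close> kill \<open>y\<close>.
\<close>

section \<open>Linear maps, quotients and free modules\<close>

lemma linear_mapsD:
  assumes "h \<in> linear_maps K V W"
  shows "x \<in> carrier V \<Longrightarrow> h x \<in> carrier W"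
    and "x \<in> carrier V \<Longrightarrow> y \<in> carrier V \<Longrightarrow> h (x \<oplus>\<^bsub>V\<^esub> y) = h x \<oplus>\<^bsub>W\<^esub> h y"
    and "c \<in> carrier K \<Longrightarrow> x \<in> carrier V \<Longrightarrow> h (c \<odot>\<^bsub>V\<^esub> x) = c \<odot>\<^bsub>W\<^esub> h x"
  using assms by (auto simp: linear_maps_def)

lemma linear_maps_zero:
  assumes "module K V" "module K W" "h \<in> linear_maps K V W"
  shows "h \<zero>\<^bsub>V\<^esub> = \<zero>\<^bsub>W\<^esub>"
proof -
  interpret V: module K V by fact
  interpret W: module K W by fact
  have "h (\<zero>\<^bsub>K\<^esub> \<odot>\<^bsub>V\<^esub> \<zero>\<^bsub>V\<^esub>) = \<zero>\<^bsub>K\<^esub> \<odot>\<^bsub>W\<^esub> h \<zero>\<^bsub>V\<^esub>"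
    by (rule linear_mapsD(3)[OF assms(3)]) auto
  then show ?thesis using linear_mapsD(1)[OF assms(3), of "\<zero>\<^bsub>V\<^esub>"] by simp
qed

lemma linear_maps_minus:
  assumes "module K V" "module K W" "h \<in> linear_maps K V W"
    and "x \<in> carrier V" "y \<in> carrier V"
  shows "h (x \<ominus>\<^bsub>V\<^esub> y) = h x \<ominus>\<^bsub>W\<^esub> h y"
proof -
  interpret V: module K V by fact
  interpret W: module K W by fact
  note h = linear_mapsD[OF assms(3)]
  have "h y \<oplus>\<^bsub>W\<^esub> h (\<ominus>\<^bsub>V\<^esub> y) = \<zero>\<^bsub>W\<^esub>"
    using h(2)[of y "\<ominus>\<^bsub>V\<^esub> y"] assms linear_maps_zero[OF assms(1-3)] by (simp add: V.r_neg)
  then have "h (\<ominus>\<^bsub>V\<^esub> y) = \<ominus>\<^bsub>W\<^esub> h y"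
    using assms h(1) by (metis V.add.inv_closed W.add.m_comm W.minus_equality)
  then show ?thesis using assms h by (simp add: a_minus_def)
qed

lemma linear_maps_inj_iff:
  assumes "module K V" "module K W" "h \<in> linear_maps K V W"
  shows "inj_on h (carrier V) \<longleftrightarrow> (\<forall>x\<in>carrier V. h x = \<zero>\<^bsub>W\<^esub> \<longrightarrow> x = \<zero>\<^bsub>V\<^esub>)"
proof -
  interpret V: module K V by fact
  interpret W: module K W by fact
  note h = linear_mapsD[OF assms(3)] linear_maps_zero[OF assms] linear_maps_minus[OF assms]
  show ?thesis
  proof
    assume inj: "inj_on h (carrier V)"
    show "\<forall>x\<in>carrier V. h x = \<zero>\<^bsub>W\<^esub> \<longrightarrow> x = \<zero>\<^bsub>V\<^esub>"
      by (intro ballI impI, rule inj_onD[OF inj _ _ V.zero_closed]) (simp_all only: h(4))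
  next
    assume *: "\<forall>x\<in>carrier V. h x = \<zero>\<^bsub>W\<^esub> \<longrightarrow> x = \<zero>\<^bsub>V\<^esub>"
    show "inj_on h (carrier V)"
    proof (rule inj_onI)
      fix x y assume xy: "x \<in> carrier V" "y \<in> carrier V" "h x = h y"
      then have "h (x \<ominus>\<^bsub>V\<^esub> y) = \<zero>\<^bsub>W\<^esub>"
        using h(1,5) by (simp add: W.minus_eq W.r_neg)
      then have "x \<oplus>\<^bsub>V\<^esub> \<ominus>\<^bsub>V\<^esub> y = \<zero>\<^bsub>V\<^esub>" using * xy by (simp add: V.minus_eq)
      then show "x = y" using xy
        by (metis V.add.inv_closed V.minus_equality V.minus_minus)
    qed
  qed
qed

locale submodule_quotient = module R M
  for R :: "'k ring" and M :: "('k, 'v) module" (structure) +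
  fixes N assumes sub: "submodule N R M"
begin

sublocale N: abelian_subgroup N M
  by (rule abelian_subgroupI3[OF additive_subgroupI[OF submodule.axioms(1)[OF sub]]])
     (rule M.abelian_group_axioms)

lemma mem_coset_iff:
  assumes "x \<in> carrier M"
  shows "y \<in> N +> x \<longleftrightarrow> y \<in> carrier M \<and> N +> y = N +> x"
proof (intro iffI conjI)
  show "y \<in> carrier M" if "y \<in> N +> x" by (rule N.a_elemrcos_carrier[OF assms that])
  show "N +> y = N +> x" if "y \<in> N +> x"
    by (rule N.a_repr_independence'[OF that assms, symmetric])
  show "y \<in> N +> x" if "y \<in> carrier M \<and> N +> y = N +> x"
    using N.a_rcos_self[of y] that by simp
qed

lemma coset_eq_iff:
  assumes "x \<in> carrier M" "y \<in> carrier M"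
  shows "N +> x = N +> y \<longleftrightarrow> x \<ominus> y \<in> N"
  using N.a_rcos_module[OF assms(2,1)] mem_coset_iff[OF assms(2), of x] assms
  by (simp add: a_minus_def)

lemma coset_eq_self_iff:
  assumes "x \<in> carrier M"
  shows "N +> x = N \<longleftrightarrow> x \<in> N"
proof
  show "x \<in> N" if "N +> x = N" using N.a_rcos_self[OF assms] by (simp only: that)
qed (rule N.a_rcos_const)

lemma quot_carrier: "carrier (quot_module M N) = (\<lambda>x. N +> x) ` carrier M"
  by (auto simp: quot_module_def A_RCOSETS_def')

lemma quot_zero: "\<zero>\<^bsub>quot_module M N\<^esub> = N"
  by (simp add: quot_module_def)

lemma quot_add:
  assumes "x \<in> carrier M" "y \<in> carrier M"
  shows "(N +> x) \<oplus>\<^bsub>quot_module M N\<^esub> (N +> y) = N +> (x \<oplus> y)"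
  using N.a_rcos_sum[OF assms] by (simp add: quot_module_def)

text \<open>
  Scalar multiplication on the quotient is the union of the cosets of \<open>c \<odot> y\<close> over all representatives
  \<open>y\<close>.  These cosets agree because \<open>c \<odot> (y \<ominus> x)\<close> stays in \<open>N\<close>.
\<close>

lemma quot_smult:
  assumes "x \<in> carrier M" "c \<in> carrier R"
  shows "c \<odot>\<^bsub>quot_module M N\<^esub> (N +> x) = N +> (c \<odot> x)"
proof -
  have "N +> (c \<odot> y) = N +> (c \<odot> x)" if y: "y \<in> N +> x" for y
  proof -
    have y': "y \<in> carrier M" "y \<ominus> x \<in> N"
      using mem_coset_iff[OF assms(1)] y coset_eq_iff[OF _ assms(1)] by auto
    then have "c \<odot> (y \<ominus> x) \<in> N" using submoduleE(4)[OF sub assms(2)] by simp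
    moreover have "c \<odot> (y \<ominus> x) = c \<odot> y \<ominus> c \<odot> x"
      using assms y' by (simp add: a_minus_def smult_r_distr smult_r_minus)
    ultimately show ?thesis using coset_eq_iff assms y' by simp
  qed
  moreover have "x \<in> N +> x" using mem_coset_iff[OF assms(1)] assms by simp
  ultimately have "(\<Union>y\<in>N +> x. N +> (c \<odot> y)) = N +> (c \<odot> x)" by blast
  then show ?thesis by (simp add: quot_module_def)
qed

lemma module_quot: "module R (quot_module M N)"
proof -
  let ?Q = "quot_module M N"
  have 0: "N +> \<zero> = N" using coset_eq_self_iff by auto
  have ab: "abelian_group ?Q"
  proof (rule abelian_groupI)
    fix X assume "X \<in> carrier ?Q"
    then obtain x where x: "x \<in> carrier M" "X = N +> x" by (auto simp: quot_carrier)
    show "\<zero>\<^bsub>?Q\<^esub> \<oplus>\<^bsub>?Q\<^esub> X = X"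
      using x quot_add[OF M.zero_closed x(1)] 0 by (simp add: quot_zero)
    have "(N +> (\<ominus> x)) \<oplus>\<^bsub>?Q\<^esub> X = \<zero>\<^bsub>?Q\<^esub>"
      using x quot_add[OF _ x(1)] 0 by (simp add: quot_zero M.l_neg)
    then show "\<exists>Y\<in>carrier ?Q. Y \<oplus>\<^bsub>?Q\<^esub> X = \<zero>\<^bsub>?Q\<^esub>" using x by (auto simp: quot_carrier)
  next
    show "\<zero>\<^bsub>?Q\<^esub> \<in> carrier ?Q" using 0 by (force simp: quot_carrier quot_zero)
  next
    fix X Y assume "X \<in> carrier ?Q" "Y \<in> carrier ?Q"
    then obtain x y where xy: "x \<in> carrier M" "X = N +> x" "y \<in> carrier M" "Y = N +> y"
      by (auto simp: quot_carrier)
    then show "X \<oplus>\<^bsub>?Q\<^esub> Y \<in> carrier ?Q" by (simp add: quot_carrier quot_add)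
    show "X \<oplus>\<^bsub>?Q\<^esub> Y = Y \<oplus>\<^bsub>?Q\<^esub> X" using xy M.a_comm by (simp add: quot_add)
    fix Z assume "Z \<in> carrier ?Q"
    then obtain z where "z \<in> carrier M" "Z = N +> z" by (auto simp: quot_carrier)
    then show "X \<oplus>\<^bsub>?Q\<^esub> Y \<oplus>\<^bsub>?Q\<^esub> Z = X \<oplus>\<^bsub>?Q\<^esub> (Y \<oplus>\<^bsub>?Q\<^esub> Z)"
      using xy by (simp add: quot_add M.a_assoc)
  qed
  show ?thesis
  proof (rule moduleI)
    fix a b X Y assume ab: "a \<in> carrier R" "b \<in> carrier R"
      and "X \<in> carrier ?Q" "Y \<in> carrier ?Q"
    then obtain x y where xy: "x \<in> carrier M" "X = N +> x" "y \<in> carrier M" "Y = N +> y"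
      by (auto simp: quot_carrier)
    show "a \<odot>\<^bsub>?Q\<^esub> X \<in> carrier ?Q"
      using xy ab by (simp add: quot_carrier quot_smult)
    show "(a \<oplus>\<^bsub>R\<^esub> b) \<odot>\<^bsub>?Q\<^esub> X = a \<odot>\<^bsub>?Q\<^esub> X \<oplus>\<^bsub>?Q\<^esub> b \<odot>\<^bsub>?Q\<^esub> X"
      using xy ab by (simp add: quot_add quot_smult smult_l_distr)
    show "a \<odot>\<^bsub>?Q\<^esub> (X \<oplus>\<^bsub>?Q\<^esub> Y) = a \<odot>\<^bsub>?Q\<^esub> X \<oplus>\<^bsub>?Q\<^esub> a \<odot>\<^bsub>?Q\<^esub> Y"
      using xy ab by (simp add: quot_add quot_smult smult_r_distr)
    show "(a \<otimes>\<^bsub>R\<^esub> b) \<odot>\<^bsub>?Q\<^esub> X = a \<odot>\<^bsub>?Q\<^esub> (b \<odot>\<^bsub>?Q\<^esub> X)"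
      using xy ab by (simp add: quot_smult smult_assoc1)
  next
    fix X assume "X \<in> carrier ?Q"
    then obtain x where "x \<in> carrier M" "X = N +> x" by (auto simp: quot_carrier)
    then show "\<one>\<^bsub>R\<^esub> \<odot>\<^bsub>?Q\<^esub> X = X" by (simp add: quot_smult)
  qed (use ab R.is_cring in auto)
qed

lemma coset_linear: "(\<lambda>x. N +> x) \<in> linear_maps R M (quot_module M N)"
  unfolding linear_maps_def
proof (intro CollectI conjI ballI funcsetI)
qed (simp_all add: quot_carrier quot_add quot_smult)

end

lemma (in module) submodule_hull:
  assumes "A \<subseteq> carrier M"
  shows "submodule ((\<lambda>H. submodule H R M) hull A) R M"
proof -
  have c: "(\<lambda>H. submodule H R M) hull A \<subseteq> carrier M"
    unfolding hull_def using assms carrier_is_submodule by blast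
  have z: "\<zero>\<^bsub>M\<^esub> \<in> H" if "submodule H R M" for H
    using subgroup.one_closed[OF submodule.axioms(1)[OF that]] by simp
  show ?thesis
  proof (rule submoduleI[OF c])
    show "\<zero>\<^bsub>M\<^esub> \<in> (\<lambda>H. submodule H R M) hull A"
      unfolding hull_def using z by blast
  qed (simp_all add: hull_def submoduleE)
qed

lemma module_free_module:
  fixes K :: "'k ring" (structure)
  assumes "cring K" shows "module K (free_module K S)"
proof -
  interpret cring K by fact
  let ?F = "free_module K S"
  have fin: "finite {s. f s \<oplus> g s \<noteq> \<zero>}"
    if "finite {s. f s \<noteq> \<zero>}" "finite {s. g s \<noteq> \<zero>}" for f g :: "'s \<Rightarrow> 'k"
  proof (rule finite_subset)
    show "{s. f s \<oplus> g s \<noteq> \<zero>} \<subseteq> {s. f s \<noteq> \<zero>} \<union> {s. g s \<noteq> \<zero>}" by auto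
  qed (use that in simp)
  have fin': "finite {s. c \<otimes> f s \<noteq> \<zero>}"
    if "finite {s. f s \<noteq> \<zero>}" "c \<in> carrier K" for c and f :: "'s \<Rightarrow> 'k"
  proof (rule finite_subset)
    show "{s. c \<otimes> f s \<noteq> \<zero>} \<subseteq> {s. f s \<noteq> \<zero>}" using that by auto
  qed (use that in simp)
  have c: "f s \<in> carrier K" if "f \<in> carrier ?F" for f s
    using that by (cases "s \<in> S") (auto simp: free_module_def)
  have ab: "abelian_group ?F"
  proof (rule abelian_groupI)
    fix f assume f: "f \<in> carrier ?F"
    show "\<exists>g\<in>carrier ?F. g \<oplus>\<^bsub>?F\<^esub> f = \<zero>\<^bsub>?F\<^esub>"
    proof
      let ?g = "\<lambda>s. \<ominus> f s"
      have "{s. ?g s \<noteq> \<zero>} \<subseteq> {s. f s \<noteq> \<zero>}" by auto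
      then show "?g \<in> carrier ?F"
        using f c[OF f] by (auto simp: free_module_def intro: finite_subset)
      show "?g \<oplus>\<^bsub>?F\<^esub> f = \<zero>\<^bsub>?F\<^esub>"
        using c[OF f] by (auto simp: free_module_def l_neg)
    qed
  next
    fix f g assume "f \<in> carrier ?F" "g \<in> carrier ?F"
    then show "f \<oplus>\<^bsub>?F\<^esub> g \<in> carrier ?F" by (auto simp: free_module_def intro!: fin)
  next
    show "\<zero>\<^bsub>?F\<^esub> \<in> carrier ?F" by (simp add: free_module_def)
  next
    fix f g h assume "f \<in> carrier ?F" "g \<in> carrier ?F" "h \<in> carrier ?F"
    note c[OF this(1)] c[OF this(2)] c[OF this(3)]
    then show "f \<oplus>\<^bsub>?F\<^esub> g \<oplus>\<^bsub>?F\<^esub> h = f \<oplus>\<^bsub>?F\<^esub> (g \<oplus>\<^bsub>?F\<^esub> h)"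
      by (simp add: free_module_def a_assoc)
  next
    fix f g assume "f \<in> carrier ?F" "g \<in> carrier ?F"
    note c[OF this(1)] c[OF this(2)]
    then show "f \<oplus>\<^bsub>?F\<^esub> g = g \<oplus>\<^bsub>?F\<^esub> f"
      by (simp add: free_module_def fun_eq_iff a_comm)
  next
    fix f assume "f \<in> carrier ?F"
    then show "\<zero>\<^bsub>?F\<^esub> \<oplus>\<^bsub>?F\<^esub> f = f"
      using c[OF \<open>f \<in> carrier ?F\<close>] by (simp add: free_module_def)
  qed
  show ?thesis
  proof (rule moduleI)
    fix a b f g assume a: "a \<in> carrier K" "b \<in> carrier K" and f: "f \<in> carrier ?F" and g: "g \<in> carrier ?F"
    show "a \<odot>\<^bsub>?F\<^esub> f \<in> carrier ?F" using a f by (auto simp: free_module_def intro!: fin')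
    show "(a \<oplus> b) \<odot>\<^bsub>?F\<^esub> f = a \<odot>\<^bsub>?F\<^esub> f \<oplus>\<^bsub>?F\<^esub> b \<odot>\<^bsub>?F\<^esub> f"
      using a c[OF f] by (simp add: free_module_def l_distr)
    show "a \<odot>\<^bsub>?F\<^esub> (f \<oplus>\<^bsub>?F\<^esub> g) = a \<odot>\<^bsub>?F\<^esub> f \<oplus>\<^bsub>?F\<^esub> a \<odot>\<^bsub>?F\<^esub> g"
      using a c[OF f] c[OF g] by (simp add: free_module_def r_distr)
    show "(a \<otimes> b) \<odot>\<^bsub>?F\<^esub> f = a \<odot>\<^bsub>?F\<^esub> (b \<odot>\<^bsub>?F\<^esub> f)"
      using a c[OF f] by (simp add: free_module_def m_assoc)
  next
    fix f assume f: "f \<in> carrier ?F"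
    show "\<one> \<odot>\<^bsub>?F\<^esub> f = f" using c[OF f] by (simp add: free_module_def)
  qed (use ab is_cring in auto)
qed

definition linear_extension :: "'k ring \<Rightarrow> ('k, 'w) module \<Rightarrow> ('s \<Rightarrow> 'w) \<Rightarrow> ('s \<Rightarrow> 'k) \<Rightarrow> 'w" where
  "linear_extension K W g f = (\<Oplus>\<^bsub>W\<^esub>s\<in>{s. f s \<noteq> \<zero>\<^bsub>K\<^esub>}. f s \<odot>\<^bsub>W\<^esub> g s)"

lemma free_map_eq_linear_extension: "free_map K F g = linear_extension K F (\<lambda>s. basis_elt K (g s))"
  by (simp add: fun_eq_iff free_map_def linear_extension_def)

lemma basis_elt_closed:
  assumes "cring K" "s \<in> S" shows "basis_elt K s \<in> carrier (free_module K S)"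
proof -
  interpret cring K by fact
  have "finite {t. basis_elt K s t \<noteq> \<zero>\<^bsub>K\<^esub>}"
    by (rule finite_subset[of _ "{s}"]) (auto simp: basis_elt_def)
  then show ?thesis using assms(2) by (auto simp: free_module_def basis_elt_def)
qed

text \<open>
  The sum defining \<open>linear_extension\<close> runs over the support, which changes under addition; enlarging it
  lets the sums for two vectors be added over a common index set.
\<close>

lemma linear_extension_superset:
  assumes "module K W" "g \<in> S \<rightarrow> carrier W" "f \<in> carrier (free_module K S)"
    and "finite A" "A \<subseteq> S" "{s. f s \<noteq> \<zero>\<^bsub>K\<^esub>} \<subseteq> A"
  shows "linear_extension K W g f = (\<Oplus>\<^bsub>W\<^esub>s\<in>A. f s \<odot>\<^bsub>W\<^esub> g s)"
proof -
  interpret W: module K W by fact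
  show ?thesis unfolding linear_extension_def
    by (rule W.add.finprod_mono_neutral_cong_left)
       (use assms in \<open>auto simp: free_module_def Pi_def subset_iff\<close>)
qed

lemma linear_extension_linear:
  assumes W: "module K W" and g: "g \<in> S \<rightarrow> carrier W"
  shows "linear_extension K W g \<in> linear_maps K (free_module K S) W"
proof -
  interpret W: module K W by fact
  interpret F: module K "free_module K S" by (rule module_free_module) (rule W.R.is_cring)
  have c: "f s \<in> carrier K" if "f \<in> carrier (free_module K S)" for f s
    using that by (cases "s \<in> S") (auto simp: free_module_def)
  have supp: "finite {s. f s \<noteq> \<zero>\<^bsub>K\<^esub>}" "{s. f s \<noteq> \<zero>\<^bsub>K\<^esub>} \<subseteq> S"
    if "f \<in> carrier (free_module K S)" for f
    using that by (auto simp: free_module_def)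
  have t: "f s \<odot>\<^bsub>W\<^esub> g s \<in> carrier W" if "f \<in> carrier (free_module K S)" "s \<in> S" for f s
    using c[OF that(1)] g that(2) by blast
  show ?thesis
    unfolding linear_maps_def
  proof (intro CollectI conjI ballI funcsetI)
    fix f assume f: "f \<in> carrier (free_module K S)"
    show "linear_extension K W g f \<in> carrier W"
      unfolding linear_extension_def using t[OF f] supp(2)[OF f] by (intro W.finsum_closed) blast
    fix h assume h: "h \<in> carrier (free_module K S)"
    let ?A = "{s. f s \<noteq> \<zero>\<^bsub>K\<^esub>} \<union> {s. h s \<noteq> \<zero>\<^bsub>K\<^esub>}"
    let ?fh = "f \<oplus>\<^bsub>free_module K S\<^esub> h"
    have A: "finite ?A" "?A \<subseteq> S" using supp[OF f] supp[OF h] by auto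
    have fh: "?fh s = f s \<oplus>\<^bsub>K\<^esub> h s" for s by (simp add: free_module_def)
    have "linear_extension K W g ?fh = (\<Oplus>\<^bsub>W\<^esub>s\<in>?A. ?fh s \<odot>\<^bsub>W\<^esub> g s)"
      by (rule linear_extension_superset[OF W g F.a_closed[OF f h] A]) (auto simp: fh)
    also have "\<dots> = (\<Oplus>\<^bsub>W\<^esub>s\<in>?A. f s \<odot>\<^bsub>W\<^esub> g s \<oplus>\<^bsub>W\<^esub> h s \<odot>\<^bsub>W\<^esub> g s)"
    proof (rule W.finsum_cong')
      show "(\<lambda>s. f s \<odot>\<^bsub>W\<^esub> g s \<oplus>\<^bsub>W\<^esub> h s \<odot>\<^bsub>W\<^esub> g s) \<in> ?A \<rightarrow> carrier W"
        using t[OF f] t[OF h] A(2) by blast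
      fix s assume "s \<in> ?A"
      then show "?fh s \<odot>\<^bsub>W\<^esub> g s = f s \<odot>\<^bsub>W\<^esub> g s \<oplus>\<^bsub>W\<^esub> h s \<odot>\<^bsub>W\<^esub> g s"
        unfolding fh using A(2) g by (intro W.smult_l_distr c[OF f] c[OF h]) blast
    qed simp
    also have "\<dots> = (\<Oplus>\<^bsub>W\<^esub>s\<in>?A. f s \<odot>\<^bsub>W\<^esub> g s) \<oplus>\<^bsub>W\<^esub> (\<Oplus>\<^bsub>W\<^esub>s\<in>?A. h s \<odot>\<^bsub>W\<^esub> g s)"
      using t[OF f] t[OF h] A(2) by (intro W.finsum_addf) blast+
    also have "(\<Oplus>\<^bsub>W\<^esub>s\<in>?A. f s \<odot>\<^bsub>W\<^esub> g s) = linear_extension K W g f"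
      by (rule linear_extension_superset[OF W g f A, symmetric]) auto
    also have "(\<Oplus>\<^bsub>W\<^esub>s\<in>?A. h s \<odot>\<^bsub>W\<^esub> g s) = linear_extension K W g h"
      by (rule linear_extension_superset[OF W g h A, symmetric]) auto
    finally show "linear_extension K W g ?fh = linear_extension K W g f \<oplus>\<^bsub>W\<^esub> linear_extension K W g h" .
  next
    fix a f assume a: "a \<in> carrier K" and f: "f \<in> carrier (free_module K S)"
    let ?A = "{s. f s \<noteq> \<zero>\<^bsub>K\<^esub>}"
    let ?af = "a \<odot>\<^bsub>free_module K S\<^esub> f"
    have af: "?af s = a \<otimes>\<^bsub>K\<^esub> f s" for s by (simp add: free_module_def)
    have "linear_extension K W g ?af = (\<Oplus>\<^bsub>W\<^esub>s\<in>?A. ?af s \<odot>\<^bsub>W\<^esub> g s)"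
      by (rule linear_extension_superset[OF W g F.smult_closed[OF a f] supp[OF f]]) (use a in \<open>auto simp: af\<close>)
    also have "\<dots> = (\<Oplus>\<^bsub>W\<^esub>s\<in>?A. a \<odot>\<^bsub>W\<^esub> (f s \<odot>\<^bsub>W\<^esub> g s))"
    proof (rule W.finsum_cong')
      show "(\<lambda>s. a \<odot>\<^bsub>W\<^esub> (f s \<odot>\<^bsub>W\<^esub> g s)) \<in> ?A \<rightarrow> carrier W"
        using t[OF f] a supp(2)[OF f] by blast
      fix s assume "s \<in> ?A"
      then show "?af s \<odot>\<^bsub>W\<^esub> g s = a \<odot>\<^bsub>W\<^esub> (f s \<odot>\<^bsub>W\<^esub> g s)"
        unfolding af using supp(2)[OF f] g by (intro W.smult_assoc1 a c[OF f]) blast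
    qed simp
    also have "\<dots> = a \<odot>\<^bsub>W\<^esub> linear_extension K W g f"
      unfolding linear_extension_def
      using t[OF f] supp[OF f] by (intro W.finsum_smult_ldistr[symmetric] a) blast+
    finally show "linear_extension K W g ?af = a \<odot>\<^bsub>W\<^esub> linear_extension K W g f" .
  qed
qed

lemma linear_extension_basis:
  assumes "field K" "module K W" "g s \<in> carrier W"
  shows "linear_extension K W g (basis_elt K s) = g s"
proof -
  interpret field K by fact
  interpret W: module K W by fact
  have "{t. basis_elt K s t \<noteq> \<zero>\<^bsub>K\<^esub>} = {s}" by (auto simp: basis_elt_def)
  then show ?thesis using assms by (simp add: linear_extension_def basis_elt_def)
qed

lemma free_module_induct [consumes 2, case_names zero add scaled_basis]:
  assumes K: "cring K" and f: "f \<in> carrier (free_module K S)"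
    and zero: "P \<zero>\<^bsub>free_module K S\<^esub>"
    and add: "\<And>f g. \<lbrakk>f \<in> carrier (free_module K S); g \<in> carrier (free_module K S); P f; P g\<rbrakk>
      \<Longrightarrow> P (f \<oplus>\<^bsub>free_module K S\<^esub> g)"
    and basis: "\<And>c s. \<lbrakk>c \<in> carrier K; s \<in> S\<rbrakk> \<Longrightarrow> P (c \<odot>\<^bsub>free_module K S\<^esub> basis_elt K s)"
  shows "P f"
proof -
  interpret cring K by fact
  interpret F: module K "free_module K S" by (rule module_free_module[OF K])
  have "\<forall>f. f \<in> carrier (free_module K S) \<longrightarrow> {s. f s \<noteq> \<zero>\<^bsub>K\<^esub>} \<subseteq> A \<longrightarrow> P f" if "finite A" for A
    using that
  proof (induction A rule: finite_induct)
    case empty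
    have "f = \<zero>\<^bsub>free_module K S\<^esub>" if "{s. f s \<noteq> \<zero>\<^bsub>K\<^esub>} \<subseteq> {}" for f
      using that by (auto simp: free_module_def)
    then show ?case using zero by blast
  next
    case (insert a A)
    show ?case
    proof (intro allI impI)
      fix f assume f: "f \<in> carrier (free_module K S)" "{s. f s \<noteq> \<zero>\<^bsub>K\<^esub>} \<subseteq> insert a A"
      show "P f"
      proof (cases "a \<in> S")
        case False
        then have "f a = \<zero>\<^bsub>K\<^esub>" using f by (simp add: free_module_def)
        then show ?thesis using insert.IH f by blast
      next
        case True
        let ?g = "f(a := \<zero>\<^bsub>K\<^esub>)" and ?h = "f a \<odot>\<^bsub>free_module K S\<^esub> basis_elt K a"
        have fa: "f a \<in> carrier K" using f True by (auto simp: free_module_def)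
        have "{s. ?g s \<noteq> \<zero>\<^bsub>K\<^esub>} \<subseteq> {s. f s \<noteq> \<zero>\<^bsub>K\<^esub>}" by auto
        then have g: "?g \<in> carrier (free_module K S)"
          using f True by (auto simp: free_module_def Pi_def intro: finite_subset)
        have h: "?h \<in> carrier (free_module K S)"
          using F.smult_closed[OF fa basis_elt_closed[OF K True]] .
        have c: "f s \<in> carrier K" for s
          using f(1) by (cases "s \<in> S") (auto simp: free_module_def)
        have "f = ?g \<oplus>\<^bsub>free_module K S\<^esub> ?h"
          using c by (auto simp: free_module_def basis_elt_def fun_eq_iff)
        moreover have "{s. ?g s \<noteq> \<zero>\<^bsub>K\<^esub>} \<subseteq> A" using f(2) by auto
        then have "P ?g" using insert.IH g by blast
        ultimately show ?thesis using add[OF g h] basis[OF fa True] by metis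
      qed
    qed
  qed
  then show ?thesis using f by (auto simp: free_module_def)
qed

section \<open>Graded modules and eventual properties\<close>

locale graded_module =
  fixes K :: "'k ring" and Qp :: "'q::ab_group_add set" and M :: "('q, 'k, 'v) qmod"
  assumes field_K: "field K" and Qp: "add_submonoid Qp" and qmodule: "is_qmodule K Qp M"
begin

lemma cring_K: "cring K"
  by (rule domain.axioms(1)[OF field.axioms(1)[OF field_K]])

lemma module_part: "module K (part M q)"
  using qmodule by (simp add: is_qmodule_def)

lemma smap_linear:
  "q' - q \<in> Qp \<Longrightarrow> smap M q q' \<in> linear_maps K (part M q) (part M q')"
  using qmodule by (simp add: is_qmodule_def qle_def)

lemma smap_closed:
  "q' - q \<in> Qp \<Longrightarrow> x \<in> carrier (part M q) \<Longrightarrow> smap M q q' x \<in> carrier (part M q')"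
  by (rule linear_mapsD(1)[OF smap_linear])

lemma smap_zero: "q' - q \<in> Qp \<Longrightarrow> smap M q q' \<zero>\<^bsub>part M q\<^esub> = \<zero>\<^bsub>part M q'\<^esub>"
  by (rule linear_maps_zero[OF module_part module_part smap_linear])

lemma smap_id: "x \<in> carrier (part M q) \<Longrightarrow> smap M q q x = x"
  using qmodule by (simp add: is_qmodule_def)

lemma smap_smap:
  "q' - q \<in> Qp \<Longrightarrow> q'' - q' \<in> Qp \<Longrightarrow> x \<in> carrier (part M q) \<Longrightarrow>
    smap M q' q'' (smap M q q' x) = smap M q q'' x"
  using qmodule by (simp add: is_qmodule_def qle_def)

lemma Qp_add: "x \<in> Qp \<Longrightarrow> y \<in> Qp \<Longrightarrow> x + y \<in> Qp"
  using Qp by (simp add: add_submonoid_def)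

lemma Qp_zero: "0 \<in> Qp"
  using Qp by (simp add: add_submonoid_def)

end

text \<open>
  \<open>\<tau>\<close> is directed by \<open>t \<le> t + t'\<close>: two translates \<open>t\<^sub>0 + \<tau>\<close> and \<open>t\<^sub>1 + \<tau>\<close> both contain \<open>t\<^sub>0 + t\<^sub>1 + \<tau>\<close>.
  The tails of this order are the translates.
\<close>

definition eventually_along :: "'q::ab_group_add set \<Rightarrow> ('q \<Rightarrow> bool) \<Rightarrow> bool" where
  "eventually_along \<tau> P \<longleftrightarrow> (\<exists>t\<^sub>0\<in>\<tau>. \<forall>t\<in>\<tau>. P (t\<^sub>0 + t))"

lemma eventually_along_conj:
  assumes "add_submonoid \<tau>" "eventually_along \<tau> P" "eventually_along \<tau> P'"
  shows "eventually_along \<tau> (\<lambda>t. P t \<and> P' t)"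
proof -
  obtain s s' where s: "s \<in> \<tau>" "s' \<in> \<tau>" "\<And>t. t \<in> \<tau> \<Longrightarrow> P (s + t)" "\<And>t. t \<in> \<tau> \<Longrightarrow> P' (s' + t)"
    using assms by (auto simp: eventually_along_def)
  have a: "x + y \<in> \<tau>" if "x \<in> \<tau>" "y \<in> \<tau>" for x y
    using that assms(1) by (simp add: add_submonoid_def)
  have "P (s + s' + t) \<and> P' (s + s' + t)" if "t \<in> \<tau>" for t
    using s(3)[OF a[OF s(2) that]] s(4)[OF a[OF s(1) that]] by (simp add: add_ac)
  then show ?thesis using a[OF s(1,2)] by (auto simp: eventually_along_def)
qed

lemma eventually_along_mono:
  assumes "add_submonoid \<tau>" "eventually_along \<tau> P" "\<And>t. t \<in> \<tau> \<Longrightarrow> P t \<Longrightarrow> P' t"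
  shows "eventually_along \<tau> P'"
  using assms unfolding eventually_along_def add_submonoid_def by metis

lemma eventually_along_witness:
  assumes "add_submonoid \<tau>" "eventually_along \<tau> P" obtains t where "t \<in> \<tau>" "P t"
proof -
  obtain t0 where "t0 \<in> \<tau>" "\<forall>t\<in>\<tau>. P (t0 + t)" using assms(2) by (auto simp: eventually_along_def)
  moreover have "0 \<in> \<tau>" using assms(1) by (simp add: add_submonoid_def)
  ultimately show ?thesis using that[of t0] by force
qed

lemma eventually_alongI:
  assumes "add_submonoid \<tau>" "\<And>t. t \<in> \<tau> \<Longrightarrow> P t" shows "eventually_along \<tau> P"
  using assms unfolding eventually_along_def add_submonoid_def by metis

lemma add_subgroup_hull:
  assumes "add_submonoid \<tau>"
  shows "add_subgroup hull \<tau> = {x - y | x y. x \<in> \<tau> \<and> y \<in> \<tau>}" (is "_ = ?D")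
proof (rule hull_unique)
  have 0: "0 \<in> \<tau>" and a: "\<And>x y. x \<in> \<tau> \<Longrightarrow> y \<in> \<tau> \<Longrightarrow> x + y \<in> \<tau>"
    using assms by (auto simp: add_submonoid_def)
  show "\<tau> \<subseteq> ?D" using 0 by force
  show "add_subgroup ?D"
    unfolding add_subgroup_def add_submonoid_def
  proof (intro conjI ballI)
    show "0 \<in> ?D" using 0 by force
    fix u assume "u \<in> ?D"
    then obtain x y where u: "u = x - y" "x \<in> \<tau>" "y \<in> \<tau>" by blast
    then have "- u = y - x" by simp
    then show "- u \<in> ?D" using u by blast
    fix v assume "v \<in> ?D"
    then obtain x' y' where v: "v = x' - y'" "x' \<in> \<tau>" "y' \<in> \<tau>" by blast
    have "u + v = (x + x') - (y + y')" using u v by simp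
    then show "u + v \<in> ?D" using a u v by blast
  qed
  fix T assume T: "\<tau> \<subseteq> T" "add_subgroup T"
  show "?D \<subseteq> T"
  proof
    fix u assume "u \<in> ?D"
    then obtain x y where u: "u = x - y" "x \<in> \<tau>" "y \<in> \<tau>" by blast
    have "x + (- y) \<in> T" using u T unfolding add_subgroup_def add_submonoid_def by blast
    then show "u \<in> T" using u by simp
  qed
qed

section \<open>The localization as a direct limit\<close>

locale localized_module = graded_module K Qp M
  for K :: "'k ring" and Qp :: "'q::ab_group_add set" and M :: "('q, 'k, 'v) qmod" +
  fixes \<tau> :: "'q set"
  assumes \<tau>: "add_submonoid \<tau>" and \<tau>_sub: "\<tau> \<subseteq> Qp"
begin

abbreviation "B \<equiv> loc_cone Qp \<tau>"
abbreviation "A \<equiv> monoid_algebra K B"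
abbreviation "F \<equiv> tensor_free K M A"
abbreviation "null \<equiv> tensor_null K Qp M A"
abbreviation "cls \<equiv> tensor_class K Qp M A"
abbreviation "L \<equiv> localization K Qp \<tau> M"
abbreviation "symb a m b n \<equiv> basis_elt K ((a, m), (b, n))"

interpretation K: field K by (rule field_K)
interpretation V: module K "part M q" for q by (rule module_part)

lemma \<tau>_add: "x \<in> \<tau> \<Longrightarrow> y \<in> \<tau> \<Longrightarrow> x + y \<in> \<tau>"
  using \<tau> by (simp add: add_submonoid_def)

lemma \<tau>_zero: "0 \<in> \<tau>"
  using \<tau> by (simp add: add_submonoid_def)

lemma loc_cone_iff: "b \<in> B \<longleftrightarrow> (\<exists>t\<in>\<tau>. b + t \<in> Qp)"
proof
  assume "b \<in> B"
  then obtain p x y where b: "b = p + (x - y)" "p \<in> Qp" "x \<in> \<tau>" "y \<in> \<tau>"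
    unfolding loc_cone_def add_subgroup_hull[OF \<tau>] by blast
  then have "b + y = p + x" by simp
  then have "b + y \<in> Qp" using Qp_add b \<tau>_sub by auto
  then show "\<exists>t\<in>\<tau>. b + t \<in> Qp" using b by blast
next
  assume "\<exists>t\<in>\<tau>. b + t \<in> Qp"
  then obtain t where t: "t \<in> \<tau>" "b + t \<in> Qp" by blast
  then have "b = (b + t) + (0 - t)" by simp
  then show "b \<in> B" unfolding loc_cone_def add_subgroup_hull[OF \<tau>] using t \<tau>_zero by blast
qed

lemma eventually_cone: "b \<in> B \<Longrightarrow> eventually_along \<tau> (\<lambda>t. b + t \<in> Qp)"
  unfolding loc_cone_iff eventually_along_def
  using Qp_add \<tau>_sub by (metis add.assoc subsetD)

lemma loc_cone_add: "b \<in> B \<Longrightarrow> p \<in> Qp \<Longrightarrow> b + p \<in> B"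
  unfolding loc_cone_iff using Qp_add by (metis add.assoc add.commute)

lemma loc_cone_neg: "t \<in> \<tau> \<Longrightarrow> - t \<in> B"
  unfolding loc_cone_iff using Qp_zero by force

lemma part_A [simp]:
  "n \<in> carrier (part A b) \<longleftrightarrow> n \<in> carrier K \<and> (b \<in> B \<or> n = \<zero>\<^bsub>K\<^esub>)"
  "\<zero>\<^bsub>part A b\<^esub> = \<zero>\<^bsub>K\<^esub>" "x \<oplus>\<^bsub>part A b\<^esub> y = x \<oplus>\<^bsub>K\<^esub> y" "c \<odot>\<^bsub>part A b\<^esub> x = c \<otimes>\<^bsub>K\<^esub> x"
  "smap A b b' n = n"
  by (auto simp: monoid_algebra_def)

lemma tensor_syms_iff:
  "((a, m), (b, n)) \<in> tensor_syms M A q \<longleftrightarrow>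
     a + b = q \<and> m \<in> carrier (part M a) \<and> n \<in> carrier (part A b)"
  by (simp add: tensor_syms_def)

lemma module_F: "module K (F q)"
  by (rule module_free_module[OF cring_K])

interpretation F: module K "F q" for q by (rule module_F)

lemma sym_closed:
  "a + b = q \<Longrightarrow> m \<in> carrier (part M a) \<Longrightarrow> n \<in> carrier (part A b) \<Longrightarrow> symb a m b n \<in> carrier (F q)"
  by (rule basis_elt_closed[OF cring_K]) (simp add: tensor_syms_iff)

text \<open>
  The value at \<open>t\<close> of a tensor \<open>m \<otimes> n x\<^sup>b\<close> of total degree \<open>q\<close>: multiply by \<open>x\<^sup>t\<close> and let the monomial
  \<open>x\<^bsup>b + t\<^esup>\<close> act on \<open>m\<close>, which lands in degree \<open>q + t\<close>.  This needs \<open>b + t\<close> in the positive cone.  The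
  default value \<open>\<zero>\<close> elsewhere does no harm: either \<open>b\<close> is in the localized cone, and then \<open>b + t\<close> is
  eventually positive, or \<open>n = \<zero>\<close>.
\<close>

definition sym_val :: "'q \<Rightarrow> 'q \<Rightarrow> ('q, 'v, 'k) tsym \<Rightarrow> 'v" where
  "sym_val q t = (\<lambda>((a, m), (b, n)).
     if b + t \<in> Qp then n \<odot>\<^bsub>part M (q + t)\<^esub> smap M a (q + t) m else \<zero>\<^bsub>part M (q + t)\<^esub>)"

definition val :: "'q \<Rightarrow> 'q \<Rightarrow> (('q, 'v, 'k) tsym \<Rightarrow> 'k) \<Rightarrow> 'v" where
  "val q t = linear_extension K (part M (q + t)) (sym_val q t)"

lemma sym_val_closed: "s \<in> tensor_syms M A q \<Longrightarrow> sym_val q t s \<in> carrier (part M (q + t))"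
proof -
  assume "s \<in> tensor_syms M A q"
  then obtain a m b n where s: "s = ((a, m), (b, n))" "a + b = q" "m \<in> carrier (part M a)" "n \<in> carrier K"
    by (auto simp: tensor_syms_def)
  have "smap M a (q + t) m \<in> carrier (part M (q + t))" if "b + t \<in> Qp"
    by (rule smap_closed[OF _ s(3)]) (use that s(2) in \<open>simp add: algebra_simps flip: s(2)\<close>)
  then show ?thesis using s by (simp add: sym_val_def)
qed

lemma val_linear: "val q t \<in> linear_maps K (F q) (part M (q + t))"
  unfolding val_def by (rule linear_extension_linear[OF module_part]) (use sym_val_closed in blast)

lemma val_sym:
  assumes "a + b = q" "m \<in> carrier (part M a)" "n \<in> carrier (part A b)"
  shows "val q t (symb a m b n) = sym_val q t ((a, m), (b, n))"
  unfolding val_def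
  by (rule linear_extension_basis[OF field_K module_part], rule sym_val_closed)
     (simp add: tensor_syms_iff assms del: part_A)

lemmas val_closed = linear_mapsD(1)[OF val_linear]
lemmas val_add = linear_mapsD(2)[OF val_linear]
lemmas val_smult = linear_mapsD(3)[OF val_linear]
lemmas val_zero = linear_maps_zero[OF module_F module_part val_linear]
lemmas val_minus = linear_maps_minus[OF module_F module_part val_linear]

text \<open>
  The linearity relations have value zero at every \<open>t\<close>.  The balancing relation needs \<open>t\<close> far out: when
  \<open>b + p + t\<close> is already in the positive cone but \<open>b + t\<close> is not, only one of the two tensors has left the
  default value.
\<close>

lemma rel_closed_and_eventually_zero:
  assumes "r \<in> tensor_rels K Qp M A q"
  shows "r \<in> carrier (F q) \<and> eventually_along \<tau> (\<lambda>t. val q t r = \<zero>\<^bsub>part M (q + t)\<^esub>)"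
proof -
  have neg: "b + t \<notin> Qp" if "b \<notin> B" "t \<in> \<tau>" for b t
    using that loc_cone_iff by blast
  have diff: "x \<ominus>\<^bsub>F q\<^esub> y \<in> carrier (F q) \<and>
      eventually_along \<tau> (\<lambda>t. val q t (x \<ominus>\<^bsub>F q\<^esub> y) = \<zero>\<^bsub>part M (q + t)\<^esub>)"
    if "x \<in> carrier (F q)" "y \<in> carrier (F q)"
      "eventually_along \<tau> (\<lambda>t. val q t x = val q t y)" for x y
    using that(3)
    by (intro conjI F.minus_closed that(1,2), elim eventually_along_mono[OF \<tau>])
       (simp add: val_minus[OF that(1,2)] val_closed[OF that(2)] V.minus_eq V.r_neg)
  have deg: "q + t - a = b + t" if "a + b = q" for a b t
    using that by (auto simp: algebra_simps)
  consider
    (add1) a m m' b n where "a + b = q" "m \<in> carrier (part M a)" "m' \<in> carrier (part M a)"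
      "n \<in> carrier (part A b)"
      "r = symb a (m \<oplus>\<^bsub>part M a\<^esub> m') b n \<ominus>\<^bsub>F q\<^esub> (symb a m b n \<oplus>\<^bsub>F q\<^esub> symb a m' b n)"
  | (add2) a m b n n' where "a + b = q" "m \<in> carrier (part M a)" "n \<in> carrier (part A b)"
      "n' \<in> carrier (part A b)"
      "r = symb a m b (n \<oplus>\<^bsub>part A b\<^esub> n') \<ominus>\<^bsub>F q\<^esub> (symb a m b n \<oplus>\<^bsub>F q\<^esub> symb a m b n')"
  | (smult1) a m b n c where "a + b = q" "c \<in> carrier K" "m \<in> carrier (part M a)"
      "n \<in> carrier (part A b)"
      "r = symb a (c \<odot>\<^bsub>part M a\<^esub> m) b n \<ominus>\<^bsub>F q\<^esub> c \<odot>\<^bsub>F q\<^esub> symb a m b n"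
  | (smult2) a m b n c where "a + b = q" "c \<in> carrier K" "m \<in> carrier (part M a)"
      "n \<in> carrier (part A b)"
      "r = symb a m b (c \<odot>\<^bsub>part A b\<^esub> n) \<ominus>\<^bsub>F q\<^esub> c \<odot>\<^bsub>F q\<^esub> symb a m b n"
  | (balance) a m b n p where "a + p + b = q" "p \<in> Qp" "m \<in> carrier (part M a)"
      "n \<in> carrier (part A b)"
      "r = symb (a + p) (smap M a (a + p) m) b n \<ominus>\<^bsub>F q\<^esub> symb a m (b + p) (smap A b (b + p) n)"
    using assms unfolding tensor_rels_def Let_def Un_iff mem_Collect_eq
    by (elim disjE exE conjE) (rule that; assumption)+
  then show ?thesis
  proof cases
    case add1
    note [simp del] = part_A
    have c: "m \<oplus>\<^bsub>part M a\<^esub> m' \<in> carrier (part M a)" using add1 by simp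
    note cl = sym_closed[OF add1(1) c add1(4)] sym_closed[OF add1(1,2,4)] sym_closed[OF add1(1,3,4)]
    have n: "n \<in> carrier K" using add1(4) by (simp add: part_A)
    show ?thesis unfolding add1(5)
    proof (rule diff[OF cl(1) F.a_closed[OF cl(2,3)]], rule eventually_alongI[OF \<tau>])
      fix t assume "t \<in> \<tau>"
      show "val q t (symb a (m \<oplus>\<^bsub>part M a\<^esub> m') b n) = val q t (symb a m b n \<oplus>\<^bsub>F q\<^esub> symb a m' b n)"
      proof (cases "b + t \<in> Qp")
        case True
        note l = smap_linear[of "q + t" a, unfolded deg[OF add1(1)], OF True]
        show ?thesis
          using True n linear_mapsD(1)[OF l add1(2)] linear_mapsD(1)[OF l add1(3)]
          by (simp add: val_add[OF cl(2,3)] val_sym[OF add1(1) c add1(4)] val_sym[OF add1(1,2,4)]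
              val_sym[OF add1(1,3,4)] sym_val_def linear_mapsD(2)[OF l add1(2,3)] V.smult_r_distr)
      qed (simp add: val_add[OF cl(2,3)] val_sym[OF add1(1) c add1(4)] val_sym[OF add1(1,2,4)]
              val_sym[OF add1(1,3,4)] sym_val_def)
    qed
  next
    case add2
    have c: "n \<oplus>\<^bsub>part A b\<^esub> n' \<in> carrier (part A b)" using add2 by auto
    note cl = sym_closed[OF add2(1,2) c] sym_closed[OF add2(1-3)] sym_closed[OF add2(1,2,4)]
    have n: "n \<in> carrier K" "n' \<in> carrier K" using add2 by auto
    note [simp] = val_add[OF cl(2,3)] val_sym[OF add2(1,2) c, simplified] val_sym[OF add2(1-3)]
              val_sym[OF add2(1,2,4)]
    show ?thesis unfolding add2(5)
    proof (rule diff[OF cl(1) F.a_closed[OF cl(2,3)]], rule eventually_alongI[OF \<tau>])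
      fix t assume "t \<in> \<tau>"
      show "val q t (symb a m b (n \<oplus>\<^bsub>part A b\<^esub> n')) = val q t (symb a m b n \<oplus>\<^bsub>F q\<^esub> symb a m b n')"
      proof (cases "b + t \<in> Qp")
        case True
        note l = smap_linear[of "q + t" a, unfolded deg[OF add2(1)], OF True]
        show ?thesis
          using True n linear_mapsD(1)[OF l add2(2)]
          by (simp add: sym_val_def V.smult_l_distr)
      qed (simp add: sym_val_def)
    qed
  next
    case smult1
    note [simp del] = part_A
    have c: "c \<odot>\<^bsub>part M a\<^esub> m \<in> carrier (part M a)" using smult1 by simp
    note cl = sym_closed[OF smult1(1) c smult1(4)] sym_closed[OF smult1(1,3,4)]
    have n: "n \<in> carrier K" using smult1(4) by (simp add: part_A)
    note [simp] = val_smult[OF smult1(2) cl(2)] val_sym[OF smult1(1) c smult1(4)]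
      val_sym[OF smult1(1,3,4)]
    show ?thesis unfolding smult1(5)
    proof (rule diff[OF cl(1) F.smult_closed[OF smult1(2) cl(2)]], rule eventually_alongI[OF \<tau>])
      fix t assume "t \<in> \<tau>"
      show "val q t (symb a (c \<odot>\<^bsub>part M a\<^esub> m) b n) = val q t (c \<odot>\<^bsub>F q\<^esub> symb a m b n)"
      proof (cases "b + t \<in> Qp")
        case True
        note l = smap_linear[of "q + t" a, unfolded deg[OF smult1(1)], OF True]
        note m = linear_mapsD(1)[OF l smult1(3)]
        show ?thesis
          using True K.m_comm[OF smult1(2) n]
          by (simp add: sym_val_def linear_mapsD(3)[OF l smult1(2,3)]
             V.smult_assoc1[OF n smult1(2) m, symmetric] V.smult_assoc1[OF smult1(2) n m, symmetric])
      qed (simp add: sym_val_def smult1(2))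
    qed
  next
    case smult2
    have c: "c \<odot>\<^bsub>part A b\<^esub> n \<in> carrier (part A b)" using smult2 by auto
    note cl = sym_closed[OF smult2(1,3) c] sym_closed[OF smult2(1,3,4)]
    have n: "n \<in> carrier K" using smult2 by auto
    note [simp] = val_smult[OF smult2(2) cl(2)] val_sym[OF smult2(1,3) c, simplified]
      val_sym[OF smult2(1,3,4)]
    show ?thesis unfolding smult2(5)
    proof (rule diff[OF cl(1) F.smult_closed[OF smult2(2) cl(2)]], rule eventually_alongI[OF \<tau>])
      fix t assume "t \<in> \<tau>"
      show "val q t (symb a m b (c \<odot>\<^bsub>part A b\<^esub> n)) = val q t (c \<odot>\<^bsub>F q\<^esub> symb a m b n)"
      proof (cases "b + t \<in> Qp")
        case True
        note l = smap_linear[of "q + t" a, unfolded deg[OF smult2(1)], OF True]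
        note m = linear_mapsD(1)[OF l smult2(3)]
        show ?thesis
          using True by (simp add: sym_val_def V.smult_assoc1[OF smult2(2) n m])
      qed (simp add: sym_val_def smult2(2))
    qed
  next
    case balance
    have n: "n \<in> carrier K" using balance by auto
    have p: "a + p - a \<in> Qp" using balance by simp
    note m = smap_closed[OF p balance(3)]
    have n': "smap A b (b + p) n \<in> carrier (part A (b + p))"
      using balance loc_cone_add[of b p] by auto
    have d: "a + (b + p) = q" using balance(1) by (simp add: add_ac)
    note cl = sym_closed[OF balance(1) m balance(4)] sym_closed[OF d balance(3) n']
    note [simp] = val_sym[OF balance(1) m balance(4)] val_sym[OF d balance(3) n', simplified]
    show ?thesis unfolding balance(5)
    proof (rule diff[OF cl])
      show "eventually_along \<tau> (\<lambda>t. val q t (symb (a + p) (smap M a (a + p) m) b n) =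
          val q t (symb a m (b + p) (smap A b (b + p) n)))"
      proof (cases "b \<in> B")
        case True
        show ?thesis
        proof (rule eventually_along_mono[OF \<tau> eventually_cone[OF True]])
          fix t assume t: "t \<in> \<tau>" "b + t \<in> Qp"
          have "b + p + t \<in> Qp" using Qp_add[OF t(2) balance(2)] by (simp add: add_ac)
          moreover have "smap M (a + p) (q + t) (smap M a (a + p) m) = smap M a (q + t) m"
            by (rule smap_smap[OF p _ balance(3)]) (simp add: deg[OF balance(1)] t)
          ultimately show "val q t (symb (a + p) (smap M a (a + p) m) b n) =
              val q t (symb a m (b + p) (smap A b (b + p) n))"
            using t by (simp add: sym_val_def)
        qed
      next
        case False
        then have n0: "n = \<zero>\<^bsub>K\<^esub>" using balance by simp
        show ?thesis
        proof (rule eventually_alongI[OF \<tau>])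
          fix t assume t: "t \<in> \<tau>"
          have "\<zero>\<^bsub>K\<^esub> \<odot>\<^bsub>part M (q + t)\<^esub> smap M a (q + t) m = \<zero>\<^bsub>part M (q + t)\<^esub>"
            if "b + p + t \<in> Qp"
            by (rule V.smult_l_null, rule smap_closed[OF _ balance(3)]) (simp only: deg[OF d] that)
          then show "val q t (symb (a + p) (smap M a (a + p) m) b n) =
              val q t (symb a m (b + p) (smap A b (b + p) n))"
            using neg[OF False t]
            unfolding val_sym[OF balance(1) m balance(4)] val_sym[OF d balance(3) n']
            by (simp add: sym_val_def n0)
        qed
      qed
    qed
  qed
qed

section \<open>Eventual values determine the classes\<close>

lemma null_submodule: "submodule (null q) K (F q)"
  unfolding tensor_null_def
  by (rule F.submodule_hull) (use rel_closed_and_eventually_zero in blast)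

lemma rels_null: "r \<in> tensor_rels K Qp M A q \<Longrightarrow> r \<in> null q"
  unfolding tensor_null_def by (rule hull_inc)

lemma quotient: "submodule_quotient K (F q) (null q)"
  by (intro submodule_quotient.intro submodule_quotient_axioms.intro module_F null_submodule)

interpretation Q: submodule_quotient K "F q" "null q" for q by (rule quotient)

lemma part_L: "part L q = quot_module (F q) (null q)"
  by (simp add: localization_def tensor_qmod_def)

lemma module_L: "module K (part L q)"
  unfolding part_L by (rule Q.module_quot)

interpretation L: module K "part L q" for q by (rule module_L)

lemma cls_linear: "cls q \<in> linear_maps K (F q) (part L q)"
  using Q.coset_linear by (simp add: tensor_class_def[abs_def] part_L)

lemmas cls_closed = linear_mapsD(1)[OF cls_linear]
lemmas cls_add = linear_mapsD(2)[OF cls_linear]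
lemmas cls_smult = linear_mapsD(3)[OF cls_linear]
lemmas cls_zero = linear_maps_zero[OF module_F module_L cls_linear]

lemma L_elem: "l \<in> carrier (part L q) \<Longrightarrow> \<exists>f\<in>carrier (F q). l = cls q f"
  by (auto simp: part_L Q.quot_carrier tensor_class_def)

lemma cls_eq_iff:
  "f \<in> carrier (F q) \<Longrightarrow> g \<in> carrier (F q) \<Longrightarrow> cls q f = cls q g \<longleftrightarrow> f \<ominus>\<^bsub>F q\<^esub> g \<in> null q"
  by (simp add: tensor_class_def Q.coset_eq_iff)

lemma cls_eq_zero_iff: "f \<in> carrier (F q) \<Longrightarrow> cls q f = \<zero>\<^bsub>part L q\<^esub> \<longleftrightarrow> f \<in> null q"
  by (simp add: tensor_class_def part_L Q.quot_zero Q.coset_eq_self_iff)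

lemma mem_cls_iff:
  "f \<in> carrier (F q) \<Longrightarrow> g \<in> cls q f \<longleftrightarrow> g \<in> carrier (F q) \<and> cls q g = cls q f"
  by (simp add: tensor_class_def Q.mem_coset_iff)

text \<open>
  Vanishing eventually is stable under the module operations, so it passes from the relations to the
  submodule that they generate.
\<close>

lemma null_eventually_zero:
  assumes "f \<in> null q" shows "eventually_along \<tau> (\<lambda>t. val q t f = \<zero>\<^bsub>part M (q + t)\<^esub>)"
proof -
  let ?H = "{f \<in> carrier (F q). eventually_along \<tau> (\<lambda>t. val q t f = \<zero>\<^bsub>part M (q + t)\<^esub>)}"
  have zero: "val q t (\<ominus>\<^bsub>F q\<^esub> f) = \<zero>\<^bsub>part M (q + t)\<^esub>"
    if "f \<in> carrier (F q)" "val q t f = \<zero>\<^bsub>part M (q + t)\<^esub>" for t f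
    using val_minus[OF F.zero_closed that(1), of t] that
    by (simp add: F.minus_eq V.minus_eq val_zero)
  have "submodule ?H K (F q)"
  proof (rule F.submoduleI; (elim CollectE conjE)?; (intro CollectI conjI)?)
    show "?H \<subseteq> carrier (F q)" by (rule Collect_restrict)
    show "eventually_along \<tau> (\<lambda>t. val q t \<zero>\<^bsub>F q\<^esub> = \<zero>\<^bsub>part M (q + t)\<^esub>)"
      by (rule eventually_alongI[OF \<tau>]) (rule val_zero)
    fix f assume f: "f \<in> carrier (F q)"
      and ev: "eventually_along \<tau> (\<lambda>t. val q t f = \<zero>\<^bsub>part M (q + t)\<^esub>)"
    show "eventually_along \<tau> (\<lambda>t. val q t (\<ominus>\<^bsub>F q\<^esub> f) = \<zero>\<^bsub>part M (q + t)\<^esub>)"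
      by (rule eventually_along_mono[OF \<tau> ev]) (rule zero[OF f])
    show "eventually_along \<tau> (\<lambda>t. val q t (c \<odot>\<^bsub>F q\<^esub> f) = \<zero>\<^bsub>part M (q + t)\<^esub>)"
      if "c \<in> carrier K" for c
      by (rule eventually_along_mono[OF \<tau> ev]) (simp add: val_smult[OF that f] that)
    fix g assume g: "g \<in> carrier (F q)"
      and ev': "eventually_along \<tau> (\<lambda>t. val q t g = \<zero>\<^bsub>part M (q + t)\<^esub>)"
    show "eventually_along \<tau> (\<lambda>t. val q t (f \<oplus>\<^bsub>F q\<^esub> g) = \<zero>\<^bsub>part M (q + t)\<^esub>)"
      by (rule eventually_along_mono[OF \<tau> eventually_along_conj[OF \<tau> ev ev']])
         (simp add: val_add[OF f g])
  qed (rule F.zero_closed F.add.inv_closed F.a_closed F.smult_closed; assumption)+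
  moreover have "tensor_rels K Qp M A q \<subseteq> ?H"
    using rel_closed_and_eventually_zero by (intro subsetI CollectI)
  ultimately have "null q \<subseteq> ?H"
    unfolding tensor_null_def by (intro hull_minimal)
  then show ?thesis using assms by (simp add: subset_iff)
qed

lemma cls_rel:
  assumes "f \<ominus>\<^bsub>F q\<^esub> g \<in> tensor_rels K Qp M A q" "f \<in> carrier (F q)" "g \<in> carrier (F q)"
  shows "cls q f = cls q g"
  using cls_eq_iff[OF assms(2,3)] rels_null[OF assms(1)] by simp

lemma cls_sym_add:
  assumes "a + b = q" "m \<in> carrier (part M a)" "m' \<in> carrier (part M a)" "n \<in> carrier (part A b)"
  shows "cls q (symb a (m \<oplus>\<^bsub>part M a\<^esub> m') b n) = cls q (symb a m b n) \<oplus>\<^bsub>part L q\<^esub> cls q (symb a m' b n)"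
proof -
  note cl = sym_closed[OF assms(1) V.a_closed[OF assms(2,3)] assms(4)] sym_closed[OF assms(1,2,4)]
    sym_closed[OF assms(1,3,4)]
  have "cls q (symb a (m \<oplus>\<^bsub>part M a\<^esub> m') b n) = cls q (symb a m b n \<oplus>\<^bsub>F q\<^esub> symb a m' b n)"
    by (rule cls_rel[OF _ cl(1) F.a_closed[OF cl(2,3)]])
       (unfold tensor_rels_def Let_def, intro UnI1 CollectI exI conjI, rule refl, (rule assms)+)
  then show ?thesis by (simp only: cls_add[OF cl(2,3)])
qed

lemma cls_sym_smult1:
  assumes "a + b = q" "c \<in> carrier K" "m \<in> carrier (part M a)" "n \<in> carrier (part A b)"
  shows "cls q (symb a (c \<odot>\<^bsub>part M a\<^esub> m) b n) = c \<odot>\<^bsub>part L q\<^esub> cls q (symb a m b n)"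
proof -
  note cl = sym_closed[OF assms(1) V.smult_closed[OF assms(2,3)] assms(4)] sym_closed[OF assms(1,3,4)]
  have "cls q (symb a (c \<odot>\<^bsub>part M a\<^esub> m) b n) = cls q (c \<odot>\<^bsub>F q\<^esub> symb a m b n)"
    by (rule cls_rel[OF _ cl(1) F.smult_closed[OF assms(2) cl(2)]])
       (unfold tensor_rels_def Let_def, use assms in blast)
  then show ?thesis by (simp only: cls_smult[OF assms(2) cl(2)])
qed

lemma cls_sym_smult2:
  assumes "a + b = q" "c \<in> carrier K" "m \<in> carrier (part M a)" "n \<in> carrier (part A b)"
  shows "cls q (symb a m b (c \<otimes>\<^bsub>K\<^esub> n)) = c \<odot>\<^bsub>part L q\<^esub> cls q (symb a m b n)"
proof -
  have cn: "c \<odot>\<^bsub>part A b\<^esub> n \<in> carrier (part A b)" using assms by auto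
  note cl = sym_closed[OF assms(1,3) cn] sym_closed[OF assms(1,3,4)]
  have "cls q (symb a m b (c \<odot>\<^bsub>part A b\<^esub> n)) = cls q (c \<odot>\<^bsub>F q\<^esub> symb a m b n)"
    by (rule cls_rel[OF _ cl(1) F.smult_closed[OF assms(2) cl(2)]])
       (unfold tensor_rels_def Let_def, use assms in blast)
  then show ?thesis by (simp add: cls_smult[OF assms(2) cl(2)])
qed

lemma cls_sym_balance:
  assumes "a' + b = q" "a' - a \<in> Qp" "m \<in> carrier (part M a)" "n \<in> carrier (part A b)"
  shows "cls q (symb a' (smap M a a' m) b n) = cls q (symb a m (b + (a' - a)) n)"
proof -
  define p where "p = a' - a"
  have p: "p \<in> Qp" "a' = a + p" "a + p + b = q" "a + (b + p) = q"
    using assms by (auto simp: p_def)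
  have n: "smap A b (b + p) n \<in> carrier (part A (b + p))"
    using assms loc_cone_add[OF _ p(1)] by auto
  have m: "smap M a (a + p) m \<in> carrier (part M (a + p))"
    by (rule smap_closed) (use p assms in auto)
  have "cls q (symb (a + p) (smap M a (a + p) m) b n) = cls q (symb a m (b + p) (smap A b (b + p) n))"
    by (rule cls_rel[OF _ sym_closed[OF p(3) m assms(4)] sym_closed[OF p(4) assms(3) n]])
       (unfold tensor_rels_def Let_def, use assms p(1,3) in blast)
  then show ?thesis by (simp add: p(2))
qed

text \<open>
  The fraction \<open>m / x\<^sup>t\<close>, for \<open>m\<close> of degree \<open>q + t\<close>.
\<close>

definition germ :: "'q \<Rightarrow> 'q \<Rightarrow> 'v \<Rightarrow> (('q, 'v, 'k) tsym \<Rightarrow> 'k) set" where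
  "germ q t m = cls q (symb (q + t) m (- t) \<one>\<^bsub>K\<^esub>)"

lemma germ_linear:
  assumes "t \<in> \<tau>" shows "germ q t \<in> linear_maps K (part M (q + t)) (part L q)"
proof -
  have d: "q + t + - t = q" by simp
  have n: "\<one>\<^bsub>K\<^esub> \<in> carrier (part A (- t))" using loc_cone_neg[OF assms] by simp
  show ?thesis
    unfolding linear_maps_def germ_def
    using cls_sym_add[OF d _ _ n] cls_sym_smult1[OF d _ _ n] cls_closed[OF sym_closed[OF d _ n]]
    by blast
qed

text \<open>
  By linearity it suffices to treat one tensor \<open>m \<otimes> x\<^sup>b\<close>.  Once \<open>b + t\<close> is in the positive cone, write
  \<open>x\<^sup>b = x\<^bsup>b + t\<^esup> x\<^bsup>-t\<^esup>\<close> and use balancedness to move the first factor to \<open>m\<close>; what is left is the germ of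
  its value.
\<close>

lemma cls_eq_germ_val:
  assumes "f \<in> carrier (F q)"
  shows "eventually_along \<tau> (\<lambda>t. cls q f = germ q t (val q t f))"
  using cring_K assms
proof (induction rule: free_module_induct)
  case zero
  show ?case
    by (rule eventually_alongI[OF \<tau>])
       (simp only: cls_zero val_zero linear_maps_zero[OF module_part module_L germ_linear])
next
  case (add f g)
  show ?case
  proof (rule eventually_along_mono[OF \<tau> eventually_along_conj[OF \<tau> add(3,4)]], elim conjE)
    fix t assume t: "t \<in> \<tau>"
      and eq: "cls q f = germ q t (val q t f)" "cls q g = germ q t (val q t g)"
    show "cls q (f \<oplus>\<^bsub>F q\<^esub> g) = germ q t (val q t (f \<oplus>\<^bsub>F q\<^esub> g))"
      unfolding cls_add[OF add(1,2)] val_add[OF add(1,2)] eq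
      by (rule linear_mapsD(2)[OF germ_linear[OF t] val_closed[OF add(1)] val_closed[OF add(2)], symmetric])
  qed
next
  case (scaled_basis c s)
  obtain a m b n where s: "s = ((a, m), (b, n))" by (metis surj_pair)
  have d: "a + b = q" and m: "m \<in> carrier (part M a)" and n: "n \<in> carrier (part A b)"
    using scaled_basis(2) unfolding s tensor_syms_iff by auto
  note cl = sym_closed[OF d m n]
  have "eventually_along \<tau> (\<lambda>t. cls q (symb a m b n) = germ q t (val q t (symb a m b n)))"
  proof (cases "b \<in> B")
    case True
    show ?thesis
    proof (rule eventually_along_mono[OF \<tau> eventually_cone[OF True]])
      fix t assume t: "t \<in> \<tau>" "b + t \<in> Qp"
      have d': "q + t - a = b + t" "q + t + - t = q" "- t + (q + t - a) = b" using d by (auto simp: algebra_simps)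
      have nK: "n \<in> carrier K" using n by simp
      have 1: "\<one>\<^bsub>K\<^esub> \<in> carrier (part A (- t))" "\<one>\<^bsub>K\<^esub> \<in> carrier (part A b)"
        using loc_cone_neg[OF t(1)] True by simp_all
      have p: "q + t - a \<in> Qp" by (simp only: d' t)
      have "germ q t (val q t (symb a m b n)) = germ q t (n \<odot>\<^bsub>part M (q + t)\<^esub> smap M a (q + t) m)"
        using t by (simp add: val_sym[OF d m n] sym_val_def)
      also have "\<dots> = n \<odot>\<^bsub>part L q\<^esub> germ q t (smap M a (q + t) m)"
        by (rule linear_mapsD(3)[OF germ_linear[OF t(1)] nK smap_closed[OF p m]])
      also have "\<dots> = n \<odot>\<^bsub>part L q\<^esub> cls q (symb a m b \<one>\<^bsub>K\<^esub>)"
        unfolding germ_def by (simp only: cls_sym_balance[OF d'(2) p m 1(1)] d'(3))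
      also have "\<dots> = cls q (symb a m b (n \<otimes>\<^bsub>K\<^esub> \<one>\<^bsub>K\<^esub>))"
        by (rule cls_sym_smult2[OF d nK m 1(2), symmetric])
      finally show "cls q (symb a m b n) = germ q t (val q t (symb a m b n))"
        using nK by simp
    qed
  next
    case False
    then have n0: "n = \<zero>\<^bsub>K\<^esub>" using n by simp
    have "cls q (symb a m b (\<zero>\<^bsub>K\<^esub> \<otimes>\<^bsub>K\<^esub> n)) = \<zero>\<^bsub>K\<^esub> \<odot>\<^bsub>part L q\<^esub> cls q (symb a m b n)"
      by (rule cls_sym_smult2[OF d K.zero_closed m n])
    then have z: "cls q (symb a m b n) = \<zero>\<^bsub>part L q\<^esub>"
      using cls_closed[OF cl] by (simp add: n0)
    show ?thesis
    proof (rule eventually_alongI[OF \<tau>])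
      fix t assume t: "t \<in> \<tau>"
      have "b + t \<notin> Qp" using False loc_cone_iff t by blast
      then have "val q t (symb a m b n) = \<zero>\<^bsub>part M (q + t)\<^esub>"
        by (simp add: val_sym[OF d m n] sym_val_def)
      then show "cls q (symb a m b n) = germ q t (val q t (symb a m b n))"
        using z linear_maps_zero[OF module_part module_L germ_linear[OF t]] by simp
    qed
  qed
  then show ?case
    unfolding s cls_smult[OF scaled_basis(1) cl] val_smult[OF scaled_basis(1) cl]
    by (rule eventually_along_mono[OF \<tau>])
       (simp only: linear_mapsD(3)[OF germ_linear scaled_basis(1) val_closed[OF cl]])
qed

text \<open>
  The left-to-right direction is \<open>null_eventually_zero\<close>.  For the converse, represent the class by the germ
  of its value at a \<open>t\<close> where that value is zero.
\<close>

lemma cls_zero_iff: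
  assumes "f \<in> carrier (F q)"
  shows "cls q f = \<zero>\<^bsub>part L q\<^esub> \<longleftrightarrow> eventually_along \<tau> (\<lambda>t. val q t f = \<zero>\<^bsub>part M (q + t)\<^esub>)"
proof
  assume "cls q f = \<zero>\<^bsub>part L q\<^esub>"
  then show "eventually_along \<tau> (\<lambda>t. val q t f = \<zero>\<^bsub>part M (q + t)\<^esub>)"
    unfolding cls_eq_zero_iff[OF assms] by (rule null_eventually_zero)
next
  assume "eventually_along \<tau> (\<lambda>t. val q t f = \<zero>\<^bsub>part M (q + t)\<^esub>)"
  note eventually_along_conj[OF \<tau> cls_eq_germ_val[OF assms] this]
  then obtain t where "t \<in> \<tau>" "cls q f = germ q t (val q t f)" "val q t f = \<zero>\<^bsub>part M (q + t)\<^esub>"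
    by (rule eventually_along_witness[OF \<tau>]) (elim conjE, rule that)
  then show "cls q f = \<zero>\<^bsub>part L q\<^esub>"
    using linear_maps_zero[OF module_part module_L germ_linear] by simp
qed

lemma cls_eq_if_eventually:
  assumes f: "f \<in> carrier (F q)" and g: "g \<in> carrier (F q)"
    and ev: "eventually_along \<tau> (\<lambda>t. val q t f = val q t g)"
  shows "cls q f = cls q g"
proof -
  note eventually_along_conj[OF \<tau>
        eventually_along_conj[OF \<tau> cls_eq_germ_val[OF f] cls_eq_germ_val[OF g]] ev]
  then obtain t where "t \<in> \<tau>" "cls q f = germ q t (val q t f)" "cls q g = germ q t (val q t g)"
    "val q t f = val q t g"
    by (rule eventually_along_witness[OF \<tau>]) (elim conjE, rule that)
  then show ?thesis by simp
qed

lemma eventually_val_eq: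
  assumes f: "f \<in> carrier (F q)" and g: "g \<in> carrier (F q)" and eq: "cls q f = cls q g"
  shows "eventually_along \<tau> (\<lambda>t. val q t f = val q t g)"
proof -
  have "eventually_along \<tau> (\<lambda>t. val q t (f \<ominus>\<^bsub>F q\<^esub> g) = \<zero>\<^bsub>part M (q + t)\<^esub>)"
    using eq unfolding cls_eq_iff[OF f g] by (rule null_eventually_zero)
  then show ?thesis
  proof (rule eventually_along_mono[OF \<tau>])
    fix t assume "val q t (f \<ominus>\<^bsub>F q\<^esub> g) = \<zero>\<^bsub>part M (q + t)\<^esub>"
    then have "val q t f \<oplus>\<^bsub>part M (q + t)\<^esub> \<ominus>\<^bsub>part M (q + t)\<^esub> val q t g = \<zero>\<^bsub>part M (q + t)\<^esub>"
      by (simp add: val_minus[OF f g] V.minus_eq)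
    then show "val q t f = val q t g"
      using val_closed[OF f] val_closed[OF g]
      by (metis V.add.inv_closed V.minus_equality V.minus_minus)
  qed
qed

section \<open>Structure maps of the localization\<close>

text \<open>
  The structure map of the localization on representatives.
\<close>

definition shift :: "'q \<Rightarrow> 'q \<Rightarrow> (('q, 'v, 'k) tsym \<Rightarrow> 'k) \<Rightarrow> (('q, 'v, 'k) tsym \<Rightarrow> 'k)" where
  "shift q q' = free_map K (F q') (tensor_shift A (q' - q))"

lemma tensor_shift_sym: "tensor_shift A p ((a, m), (b, n)) = ((a, m), (b + p, n))"
  by (simp add: tensor_shift_def)

lemma tensor_shift_closed:
  assumes "q' - q \<in> Qp" "s \<in> tensor_syms M A q"
  shows "tensor_shift A (q' - q) s \<in> tensor_syms M A q'"
proof -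
  obtain a m b n where s: "s = ((a, m), (b, n))" by (metis surj_pair)
  show ?thesis
    using assms loc_cone_add[OF _ assms(1), of b] unfolding s tensor_shift_sym tensor_syms_iff
    by (auto simp: algebra_simps)
qed

lemma shift_linear:
  assumes "q' - q \<in> Qp" shows "shift q q' \<in> linear_maps K (F q) (F q')"
  unfolding shift_def free_map_eq_linear_extension
  by (rule linear_extension_linear[OF module_F])
     (intro funcsetI basis_elt_closed[OF cring_K] tensor_shift_closed[OF assms])

lemma shift_sym:
  assumes "q' - q \<in> Qp" "a + b = q" "m \<in> carrier (part M a)" "n \<in> carrier (part A b)"
  shows "shift q q' (symb a m b n) = symb a m (b + (q' - q)) n"
proof -
  have s: "((a, m), (b, n)) \<in> tensor_syms M A q" using assms unfolding tensor_syms_iff by blast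
  show ?thesis
    unfolding shift_def free_map_eq_linear_extension
    by (subst linear_extension_basis[OF field_K module_F])
       (use basis_elt_closed[OF cring_K tensor_shift_closed[OF assms(1) s]] in
         \<open>simp_all add: tensor_shift_sym\<close>)
qed

text \<open>
  On values the structure map of the localization is that of \<open>M\<close>.  As values determine classes, this
  settles that it is well defined and functorial.
\<close>

lemma val_shift:
  assumes p: "q' - q \<in> Qp" and f: "f \<in> carrier (F q)"
  shows "eventually_along \<tau> (\<lambda>t. val q' t (shift q q' f) = smap M (q + t) (q' + t) (val q t f))"
  using cring_K f
proof (induction rule: free_module_induct)
  have p': "q' + t - (q + t) \<in> Qp" for t using p by simp
  note sl = shift_linear[OF p] and ml = smap_linear[OF p']
  case zero
  show ?case
    by (rule eventually_alongI[OF \<tau>])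
       (simp only: linear_maps_zero[OF module_F module_F sl] val_zero smap_zero[OF p'])
next
  have p': "q' + t - (q + t) \<in> Qp" for t using p by simp
  note sl = shift_linear[OF p] and ml = smap_linear[OF p']
  case (add f g)
  show ?case
  proof (rule eventually_along_mono[OF \<tau> eventually_along_conj[OF \<tau> add(3,4)]], elim conjE)
    fix t
    assume eq: "val q' t (shift q q' f) = smap M (q + t) (q' + t) (val q t f)"
      "val q' t (shift q q' g) = smap M (q + t) (q' + t) (val q t g)"
    show "val q' t (shift q q' (f \<oplus>\<^bsub>F q\<^esub> g)) = smap M (q + t) (q' + t) (val q t (f \<oplus>\<^bsub>F q\<^esub> g))"
      by (simp only: linear_mapsD(2)[OF sl add(1,2)] val_add[OF add(1,2)]
          val_add[OF linear_mapsD(1)[OF sl add(1)] linear_mapsD(1)[OF sl add(2)]] eq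
          linear_mapsD(2)[OF ml val_closed[OF add(1)] val_closed[OF add(2)]])
  qed
next
  have p': "q' + t - (q + t) \<in> Qp" for t using p by simp
  note sl = shift_linear[OF p] and ml = smap_linear[OF p']
  case (scaled_basis c s)
  obtain a m b n where s: "s = ((a, m), (b, n))" by (metis surj_pair)
  have d: "a + b = q" and m: "m \<in> carrier (part M a)" and n: "n \<in> carrier (part A b)"
    using scaled_basis(2) unfolding s tensor_syms_iff by auto
  have d': "a + (b + (q' - q)) = q'" and n': "n \<in> carrier (part A (b + (q' - q)))"
    using d n loc_cone_add[OF _ p, of b] by (auto simp: algebra_simps)
  have nK: "n \<in> carrier K" using n by simp
  note cl = sym_closed[OF d m n]
  have "eventually_along \<tau> (\<lambda>t. val q' t (symb a m (b + (q' - q)) n) =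
      smap M (q + t) (q' + t) (val q t (symb a m b n)))"
  proof (cases "b \<in> B")
    case True
    show ?thesis
    proof (rule eventually_along_mono[OF \<tau> eventually_cone[OF True]])
      fix t assume t: "t \<in> \<tau>" "b + t \<in> Qp"
      have t': "b + (q' - q) + t \<in> Qp" using Qp_add[OF t(2) p] by (simp add: algebra_simps)
      have a: "q + t - a \<in> Qp" using t(2) d by (auto simp: algebra_simps)
      show "val q' t (symb a m (b + (q' - q)) n) = smap M (q + t) (q' + t) (val q t (symb a m b n))"
        unfolding val_sym[OF d m n] val_sym[OF d' m n']
        using t(2) t' by (simp add: sym_val_def linear_mapsD(3)[OF ml nK smap_closed[OF a m]]
            smap_smap[OF a p' m])
    qed
  next
    case False
    then have n0: "n = \<zero>\<^bsub>K\<^esub>" using n by simp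
    show ?thesis
    proof (rule eventually_alongI[OF \<tau>])
      fix t assume t: "t \<in> \<tau>"
      have "\<zero>\<^bsub>K\<^esub> \<odot>\<^bsub>part M (q' + t)\<^esub> smap M a (q' + t) m = \<zero>\<^bsub>part M (q' + t)\<^esub>"
        if "b + (q' - q) + t \<in> Qp"
        by (rule V.smult_l_null, rule smap_closed[OF _ m]) (use that d in \<open>auto simp: algebra_simps\<close>)
      moreover have "b + t \<notin> Qp" using False loc_cone_iff t by blast
      ultimately show "val q' t (symb a m (b + (q' - q)) n) =
          smap M (q + t) (q' + t) (val q t (symb a m b n))"
        unfolding val_sym[OF d m n] val_sym[OF d' m n']
        by (simp add: sym_val_def n0 smap_zero[OF p'])
    qed
  qed
  then show ?case
    unfolding s linear_mapsD(3)[OF sl scaled_basis(1) cl] val_smult[OF scaled_basis(1) cl]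
      shift_sym[OF p d m n] val_smult[OF scaled_basis(1) sym_closed[OF d' m n']]
    by (rule eventually_along_mono[OF \<tau>])
       (simp only: linear_mapsD(3)[OF ml scaled_basis(1) val_closed[OF cl]])
qed

lemmas shift_closed = linear_mapsD(1)[OF shift_linear]

lemma smap_L_cls:
  assumes p: "q' - q \<in> Qp" and f: "f \<in> carrier (F q)"
  shows "smap L q q' (cls q f) = cls q' (shift q q' f)"
proof -
  have "cls q' (shift q q' g) = cls q' (shift q q' f)" if "g \<in> cls q f" for g
  proof -
    have g: "g \<in> carrier (F q)" and eq: "cls q g = cls q f" using mem_cls_iff[OF f] that by auto
    show ?thesis
    proof (rule cls_eq_if_eventually[OF shift_closed[OF p g] shift_closed[OF p f]],
        rule eventually_along_mono[OF \<tau> eventually_along_conj[OF \<tau> eventually_val_eq[OF g f eq]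
          eventually_along_conj[OF \<tau> val_shift[OF p g] val_shift[OF p f]]]], elim conjE)
      fix t assume "val q t g = val q t f"
        "val q' t (shift q q' g) = smap M (q + t) (q' + t) (val q t g)"
        "val q' t (shift q q' f) = smap M (q + t) (q' + t) (val q t f)"
      then show "val q' t (shift q q' g) = val q' t (shift q q' f)" by simp
    qed
  qed
  moreover have "f \<in> cls q f" using mem_cls_iff[OF f] f by blast
  ultimately have "(\<Union>g\<in>cls q f. cls q' (shift q q' g)) = cls q' (shift q q' f)" by blast
  then show ?thesis by (simp add: localization_def tensor_qmod_def shift_def)
qed

lemma qmodule_L: "is_qmodule K Qp L"
  unfolding is_qmodule_def qle_def
proof (intro conjI allI impI ballI)
  show "module K (part L q)" for q by (rule module_L)
next
  fix q q' assume p: "q' - q \<in> Qp"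
  note sl = linear_mapsD[OF shift_linear[OF p]]
  show "smap L q q' \<in> linear_maps K (part L q) (part L q')"
    unfolding linear_maps_def
  proof (intro CollectI conjI funcsetI ballI)
    fix x assume "x \<in> carrier (part L q)"
    then obtain f where f: "f \<in> carrier (F q)" "x = cls q f" using L_elem by blast
    show "smap L q q' x \<in> carrier (part L q')"
      by (simp only: f(2) smap_L_cls[OF p f(1)] cls_closed[OF sl(1)[OF f(1)]])
    show "smap L q q' (c \<odot>\<^bsub>part L q\<^esub> x) = c \<odot>\<^bsub>part L q'\<^esub> smap L q q' x" if c: "c \<in> carrier K" for c
      by (simp only: f(2) smap_L_cls[OF p f(1)] cls_smult[OF c f(1), symmetric]
          smap_L_cls[OF p F.smult_closed[OF c f(1)]] sl(3)[OF c f(1)] cls_smult[OF c sl(1)[OF f(1)]])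
    fix y assume "y \<in> carrier (part L q)"
    then obtain g where g: "g \<in> carrier (F q)" "y = cls q g" using L_elem by blast
    show "smap L q q' (x \<oplus>\<^bsub>part L q\<^esub> y) = smap L q q' x \<oplus>\<^bsub>part L q'\<^esub> smap L q q' y"
      by (simp only: f(2) g(2) smap_L_cls[OF p f(1)] smap_L_cls[OF p g(1)]
          cls_add[OF f(1) g(1), symmetric] smap_L_cls[OF p F.a_closed[OF f(1) g(1)]]
          sl(2)[OF f(1) g(1)] cls_add[OF sl(1)[OF f(1)] sl(1)[OF g(1)]])
  qed
next
  fix q x assume "x \<in> carrier (part L q)"
  then obtain f where f: "f \<in> carrier (F q)" "x = cls q f" using L_elem by blast
  have p: "q - q \<in> Qp" using Qp_zero by simp
  have "cls q (shift q q f) = cls q f"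
  proof (rule cls_eq_if_eventually[OF shift_closed[OF p f(1)] f(1)],
      rule eventually_along_mono[OF \<tau> val_shift[OF p f(1)]])
    fix t assume "val q t (shift q q f) = smap M (q + t) (q + t) (val q t f)"
    then show "val q t (shift q q f) = val q t f" by (simp only: smap_id[OF val_closed[OF f(1)]])
  qed
  then show "smap L q q x = x" by (simp only: f(2) smap_L_cls[OF p f(1)])
next
  fix q q' q'' x assume p: "q' - q \<in> Qp" "q'' - q' \<in> Qp" and "x \<in> carrier (part L q)"
  then obtain f where f: "f \<in> carrier (F q)" "x = cls q f" using L_elem by blast
  have p2: "q'' - q \<in> Qp" using Qp_add[OF p] by simp
  note s = shift_closed[OF p(1) f(1)]
  have "cls q'' (shift q' q'' (shift q q' f)) = cls q'' (shift q q'' f)"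
  proof (rule cls_eq_if_eventually[OF shift_closed[OF p(2) s] shift_closed[OF p2 f(1)]],
      rule eventually_along_mono[OF \<tau> eventually_along_conj[OF \<tau> val_shift[OF p(2) s]
        eventually_along_conj[OF \<tau> val_shift[OF p(1) f(1)] val_shift[OF p2 f(1)]]]], elim conjE)
    fix t assume eq: "val q'' t (shift q' q'' (shift q q' f)) =
        smap M (q' + t) (q'' + t) (val q' t (shift q q' f))"
      "val q' t (shift q q' f) = smap M (q + t) (q' + t) (val q t f)"
      "val q'' t (shift q q'' f) = smap M (q + t) (q'' + t) (val q t f)"
    show "val q'' t (shift q' q'' (shift q q' f)) = val q'' t (shift q q'' f)"
      unfolding eq by (rule smap_smap[OF _ _ val_closed[OF f(1)]]) (use p in simp_all)
  qed
  then show "smap L q' q'' (smap L q q' x) = smap L q q'' x"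
    by (simp only: f(2) smap_L_cls[OF p(1) f(1)] smap_L_cls[OF p(2) s] smap_L_cls[OF p2 f(1)])
qed

text \<open>
  For \<open>b \<in> \<int>\<tau>\<close> the degrees \<open>b + t\<close> eventually lie in \<open>\<tau>\<close> again, not just in the positive cone.  So the
  values of \<open>m \<otimes> x\<^sup>b\<close> are images of \<open>m\<close> along \<open>\<tau>\<close>, whatever \<open>b\<close> is.
\<close>

lemma cls_sym_zero_iff:
  assumes d: "a + b = q" and m: "m \<in> carrier (part M a)" and b: "b \<in> add_subgroup hull \<tau>"
  shows "cls q (symb a m b \<one>\<^bsub>K\<^esub>) = \<zero>\<^bsub>part L q\<^esub> \<longleftrightarrow>
    (\<exists>u\<in>\<tau>. smap M a (a + u) m = \<zero>\<^bsub>part M (a + u)\<^esub>)"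
proof -
  obtain x y where b': "b = x - y" and xy: "x \<in> \<tau>" "y \<in> \<tau>"
    using b unfolding add_subgroup_hull[OF \<tau>] by blast
  have "b = 0 + b" by simp
  then have "b \<in> B" unfolding loc_cone_def using Qp_zero b by blast
  then have n: "\<one>\<^bsub>K\<^esub> \<in> carrier (part A b)" by simp
  have val: "val q t (symb a m b \<one>\<^bsub>K\<^esub>) = smap M a (q + t) m" if "b + t \<in> Qp" for t
  proof -
    have "q + t - a \<in> Qp" using that d by (auto simp: algebra_simps)
    then show ?thesis
      using that smap_closed[OF _ m] unfolding val_sym[OF d m n] by (simp add: sym_val_def)
  qed
  show ?thesis
    unfolding cls_zero_iff[OF sym_closed[OF d m n]]
  proof
    assume "eventually_along \<tau> (\<lambda>t. val q t (symb a m b \<one>\<^bsub>K\<^esub>) = \<zero>\<^bsub>part M (q + t)\<^esub>)"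
    then obtain t0 where t0: "t0 \<in> \<tau>"
      "\<forall>t\<in>\<tau>. val q (t0 + t) (symb a m b \<one>\<^bsub>K\<^esub>) = \<zero>\<^bsub>part M (q + (t0 + t))\<^esub>"
      unfolding eventually_along_def by blast
    \<comment> \<open>Adding \<open>y\<close>, the denominator of \<open>b = x - y\<close>, turns \<open>b + t0\<close> into the element \<open>x + t0\<close> of \<open>\<tau>\<close>.\<close>
    have u: "x + t0 \<in> \<tau>" "b + (t0 + y) = x + t0" "q + (t0 + y) = a + (x + t0)"
      using \<tau>_add xy t0(1) b' d by (auto simp: algebra_simps)
    have "b + (t0 + y) \<in> Qp" unfolding u(2) using u(1) \<tau>_sub by blast
    then have "smap M a (q + (t0 + y)) m = \<zero>\<^bsub>part M (q + (t0 + y))\<^esub>"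
      using val t0(2) xy(2) by metis
    then show "\<exists>u\<in>\<tau>. smap M a (a + u) m = \<zero>\<^bsub>part M (a + u)\<^esub>"
      unfolding u(3) using u(1) by blast
  next
    assume "\<exists>u\<in>\<tau>. smap M a (a + u) m = \<zero>\<^bsub>part M (a + u)\<^esub>"
    then obtain u where u: "u \<in> \<tau>" "smap M a (a + u) m = \<zero>\<^bsub>part M (a + u)\<^esub>" by blast
    have "val q (u + y + t) (symb a m b \<one>\<^bsub>K\<^esub>) = \<zero>\<^bsub>part M (q + (u + y + t))\<^esub>" if t: "t \<in> \<tau>" for t
    proof -
      have e: "q + (u + y + t) = a + u + (x + t)" "b + (u + y + t) = u + (x + t)"
        using b' d by (auto simp: algebra_simps)
      have k: "x + t \<in> Qp" "u + (x + t) \<in> Qp" using \<tau>_sub \<tau>_add xy u t by blast+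
      have "val q (u + y + t) (symb a m b \<one>\<^bsub>K\<^esub>) = smap M a (q + (u + y + t)) m"
        by (rule val) (simp only: e k)
      also have "\<dots> = smap M (a + u) (a + u + (x + t)) (smap M a (a + u) m)"
        unfolding e(1) by (rule smap_smap[symmetric, OF _ _ m]) (use k u \<tau>_sub in auto)
      also have "\<dots> = \<zero>\<^bsub>part M (a + u + (x + t))\<^esub>"
        unfolding u(2) by (rule smap_zero) (use k in simp)
      finally show ?thesis unfolding e(1) .
    qed
    then show "eventually_along \<tau> (\<lambda>t. val q t (symb a m b \<one>\<^bsub>K\<^esub>) = \<zero>\<^bsub>part M (q + t)\<^esub>)"
      unfolding eventually_along_def using \<tau>_add[OF u(1) xy(2)] by blast
  qed
qed

lemma smap_L_sym:
  assumes p: "q' - q \<in> Qp" and s: "a + b = q" "m \<in> carrier (part M a)" "n \<in> carrier (part A b)"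
  shows "smap L q q' (cls q (symb a m b n)) = cls q' (symb a m (b + (q' - q)) n)"
  by (simp only: smap_L_cls[OF p sym_closed[OF s]] shift_sym[OF p s])

lemma hull_mem: "x \<in> \<tau> \<Longrightarrow> y \<in> \<tau> \<Longrightarrow> x - y \<in> add_subgroup hull \<tau>"
  unfolding add_subgroup_hull[OF \<tau>] by blast

lemma one_A: "t \<in> \<tau> \<Longrightarrow> \<one>\<^bsub>K\<^esub> \<in> carrier (part A (- t))" "\<one>\<^bsub>K\<^esub> \<in> carrier (part A 0)"
  using loc_cone_neg loc_cone_neg[OF \<tau>_zero] by simp_all

lemma loc_map_eq_germ: "loc_map K Qp \<tau> M q m = germ q 0 m"
  by (simp add: loc_map_def germ_def)

lemma loc_map_linear: "loc_map K Qp \<tau> M q \<in> linear_maps K (part M q) (part L q)"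
  using germ_linear[OF \<tau>_zero, of q] by (simp add: loc_map_eq_germ[abs_def])

lemma loc_map_zero_iff:
  assumes "m \<in> carrier (part M q)"
  shows "loc_map K Qp \<tau> M q m = \<zero>\<^bsub>part L q\<^esub> \<longleftrightarrow>
    (\<exists>t\<in>\<tau>. smap M q (q + t) m = \<zero>\<^bsub>part M (q + t)\<^esub>)"
  using cls_sym_zero_iff[of q 0 q, OF _ assms] hull_mem[OF \<tau>_zero \<tau>_zero] by (simp add: loc_map_def)

lemma loc_map_natural:
  assumes p: "q' - q \<in> Qp" and m: "m \<in> carrier (part M q)"
  shows "smap L q q' (loc_map K Qp \<tau> M q m) = loc_map K Qp \<tau> M q' (smap M q q' m)"
proof -
  have "smap L q q' (loc_map K Qp \<tau> M q m) = cls q' (symb q m (0 + (q' - q)) \<one>\<^bsub>K\<^esub>)"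
    unfolding loc_map_def by (rule smap_L_sym[OF p _ m one_A(2)]) simp
  also have "\<dots> = cls q' (symb q' (smap M q q' m) 0 \<one>\<^bsub>K\<^esub>)"
    by (rule cls_sym_balance[symmetric, OF _ p m one_A(2)]) simp
  finally show ?thesis by (simp only: loc_map_def)
qed

lemma L_germ:
  assumes "l \<in> carrier (part L q)"
  obtains t m where "t \<in> \<tau>" "m \<in> carrier (part M (q + t))" "l = germ q t m"
proof -
  obtain f where f: "f \<in> carrier (F q)" "l = cls q f" using L_elem[OF assms] by blast
  from cls_eq_germ_val[OF f(1)] obtain t where "t \<in> \<tau>" "cls q f = germ q t (val q t f)"
    by (rule eventually_along_witness[OF \<tau>]) (rule that)
  then show ?thesis using that[OF _ val_closed[OF f(1)]] f(2) by metis
qed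

lemma L_clear_denominator:
  assumes "l \<in> carrier (part L q)"
  obtains t m where "t \<in> \<tau>" "m \<in> carrier (part M (q + t))"
    "smap L q (q + t) l = loc_map K Qp \<tau> M (q + t) m"
proof -
  obtain t m where t: "t \<in> \<tau>" and m: "m \<in> carrier (part M (q + t))" and l: "l = germ q t m"
    by (rule L_germ[OF assms])
  have "smap L q (q + t) l = cls (q + t) (symb (q + t) m (- t + (q + t - q)) \<one>\<^bsub>K\<^esub>)"
    unfolding l germ_def by (rule smap_L_sym[OF _ _ m one_A(1)[OF t]]) (use t \<tau>_sub in auto)
  then show ?thesis using that[OF t m] by (simp add: loc_map_def)
qed

text \<open>
  The structure map only changes the exponent of \<open>m \<otimes> x\<^bsup>-s\<^esup>\<close> within \<open>\<int>\<tau>\<close>, and by \<open>cls_sym_zero_iff\<close> the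
  vanishing of such a tensor does not depend on that exponent.
\<close>

lemma smap_L_inj_along:
  assumes l: "l \<in> carrier (part L q)" and t: "t \<in> \<tau>"
    and z: "smap L q (q + t) l = \<zero>\<^bsub>part L (q + t)\<^esub>"
  shows "l = \<zero>\<^bsub>part L q\<^esub>"
proof -
  obtain s m where s: "s \<in> \<tau>" and m: "m \<in> carrier (part M (q + s))" and l: "l = germ q s m"
    by (rule L_germ[OF assms(1)])
  have "smap L q (q + t) l = cls (q + t) (symb (q + s) m (- s + (q + t - q)) \<one>\<^bsub>K\<^esub>)"
    unfolding l germ_def by (rule smap_L_sym[OF _ _ m one_A(1)[OF s]]) (use t \<tau>_sub in auto)
  then have "cls (q + t) (symb (q + s) m (t - s) \<one>\<^bsub>K\<^esub>) = \<zero>\<^bsub>part L (q + t)\<^esub>" using z by simp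
  then have "\<exists>u\<in>\<tau>. smap M (q + s) (q + s + u) m = \<zero>\<^bsub>part M (q + s + u)\<^esub>"
    by (subst (asm) cls_sym_zero_iff[OF _ m hull_mem[OF t s]]) simp_all
  then have "cls q (symb (q + s) m (0 - s) \<one>\<^bsub>K\<^esub>) = \<zero>\<^bsub>part L q\<^esub>"
    by (subst cls_sym_zero_iff[OF _ m hull_mem[OF \<tau>_zero s]]) simp_all
  then show ?thesis by (simp add: l germ_def)
qed

end

section \<open>Faces and global support\<close>

lemma sum_const_lessThan_add:
  fixes f :: "'q::ab_group_add" and k l :: nat
  shows "(\<Sum>i<k + l. f) = (\<Sum>i<k. f) + (\<Sum>i<l. f)"
  by (induction k) (simp_all add: add_ac)

lemma sum_const_mem:
  assumes "add_submonoid S" "f \<in> S" shows "(\<Sum>i<l::nat. f) \<in> S"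
  using assms by (induction l) (auto simp: add_submonoid_def)

text \<open>
  This is the smallest face that contains \<open>f\<close>.  Each of its elements lies below a multiple of \<open>f\<close>, so that
  whatever some element of it kills is killed by all high multiples of \<open>f\<close>: this turns statements about
  faces into statements about transience.
\<close>

lemma face_generated_by_element:
  assumes Qp: "add_submonoid Qp" and f: "f \<in> Qp"
  shows "face Qp {x \<in> Qp. \<exists>l::nat. (\<Sum>i<l. f) - x \<in> Qp}" (is "face Qp ?S")
proof -
  have a: "x + y \<in> Qp" if "x \<in> Qp" "y \<in> Qp" for x y
    using that Qp by (simp add: add_submonoid_def)
  have 0: "0 \<in> Qp" using Qp by (simp add: add_submonoid_def)
  show ?thesis
    unfolding face_def monoid_ideal_def add_submonoid_def
  proof (intro conjI ballI)
    have "(\<Sum>i<0::nat. f) - 0 \<in> Qp" using 0 by simp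
    then show "0 \<in> ?S" using 0 by blast
    fix x y assume "x \<in> ?S" "y \<in> ?S"
    then obtain k l :: nat where kl: "x \<in> Qp" "y \<in> Qp" "(\<Sum>i<k. f) - x \<in> Qp" "(\<Sum>i<l. f) - y \<in> Qp"
      by blast
    have "(\<Sum>i<k + l. f) - (x + y) = ((\<Sum>i<k. f) - x) + ((\<Sum>i<l. f) - y)"
      unfolding sum_const_lessThan_add by simp
    then have "(\<Sum>i<k + l. f) - (x + y) \<in> Qp" using a[OF kl(3,4)] by (simp only:)
    then show "x + y \<in> ?S" using a kl by blast
  next
    fix x p assume x: "x \<in> Qp - ?S" and p: "p \<in> Qp"
    have "x + p \<notin> ?S"
    proof
      assume "x + p \<in> ?S"
      then obtain l :: nat where "(\<Sum>i<l. f) - (x + p) \<in> Qp" by blast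
      from a[OF this p] have "(\<Sum>i<l. f) - x \<in> Qp" by simp
      then show False using x by blast
    qed
    then show "x + p \<in> Qp - ?S" using a x p by blast
  qed blast+
qed

context graded_module
begin

lemma localized_module: "face Qp \<tau> \<Longrightarrow> localized_module K Qp M \<tau>"
  by (intro localized_module.intro localized_module_axioms.intro graded_module_axioms)
     (auto simp: face_def)

lemma global_support_iff:
  "m \<in> global_support K Qp \<tau> M q \<longleftrightarrow> m \<in> carrier (part M q) \<and>
     (\<forall>\<tau>'. face Qp \<tau>' \<and> \<not> \<tau>' \<subseteq> \<tau> \<longrightarrow> (\<exists>t\<in>\<tau>'. smap M q (q + t) m = \<zero>\<^bsub>part M (q + t)\<^esub>))"
  using localized_module.loc_map_zero_iff[OF localized_module, of _ m q]
  unfolding global_support_def by blast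

lemma global_support_submodule: "is_qsubmodule K Qp M (global_support K Qp \<tau> M)"
  unfolding is_qsubmodule_def qle_def
proof (intro conjI allI impI funcsetI)
  fix q
  interpret V: module K "part M q" by (rule module_part)
  have z: "loc_map K Qp \<tau>' M q \<in> linear_maps K (part M q) (part (localization K Qp \<tau>' M) q)"
    "module K (part (localization K Qp \<tau>' M) q)" if "face Qp \<tau>'" for \<tau>'
    using localized_module.loc_map_linear localized_module.module_L localized_module[OF that] by blast+
  show "submodule (global_support K Qp \<tau> M q) K (part M q)"
    unfolding global_support_def
  proof (rule V.submoduleI; (elim CollectE conjE)?; (intro CollectI conjI allI impI; (elim conjE)?)?)
    show "{m \<in> carrier (part M q). \<forall>\<tau>'. face Qp \<tau>' \<and> \<not> \<tau>' \<subseteq> \<tau> \<longrightarrow>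
        loc_map K Qp \<tau>' M q m = \<zero>\<^bsub>part (localization K Qp \<tau>' M) q\<^esub>} \<subseteq> carrier (part M q)"
      by (rule Collect_restrict)
    fix \<tau>' assume \<tau>': "face Qp \<tau>'" "\<not> \<tau>' \<subseteq> \<tau>"
    let ?h = "loc_map K Qp \<tau>' M q" and ?W = "part (localization K Qp \<tau>' M) q"
    interpret W: module K ?W by (rule z(2)[OF \<tau>'(1)])
    note h = linear_mapsD[OF z(1)[OF \<tau>'(1)]]
    note h0 = linear_maps_zero[OF module_part z(2,1)[OF \<tau>'(1)]]
    show "?h \<zero>\<^bsub>part M q\<^esub> = \<zero>\<^bsub>?W\<^esub>" by (rule h0)
    fix x assume x: "x \<in> carrier (part M q)"
      and "\<forall>\<tau>'. face Qp \<tau>' \<and> \<not> \<tau>' \<subseteq> \<tau> \<longrightarrow>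
        loc_map K Qp \<tau>' M q x = \<zero>\<^bsub>part (localization K Qp \<tau>' M) q\<^esub>"
    with \<tau>' have x0: "?h x = \<zero>\<^bsub>?W\<^esub>" by blast
    show "?h (\<ominus>\<^bsub>part M q\<^esub> x) = \<zero>\<^bsub>?W\<^esub>"
      using linear_maps_minus[OF module_part z(2,1)[OF \<tau>'(1)] V.zero_closed x] x x0
      by (simp add: V.minus_eq W.minus_eq h0)
    show "?h (c \<odot>\<^bsub>part M q\<^esub> x) = \<zero>\<^bsub>?W\<^esub>" if "c \<in> carrier K" for c
      by (simp add: h(3)[OF that x] x0 that)
    fix y assume y: "y \<in> carrier (part M q)"
      and "\<forall>\<tau>'. face Qp \<tau>' \<and> \<not> \<tau>' \<subseteq> \<tau> \<longrightarrow>
        loc_map K Qp \<tau>' M q y = \<zero>\<^bsub>part (localization K Qp \<tau>' M) q\<^esub>"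
    with \<tau>' have y0: "?h y = \<zero>\<^bsub>?W\<^esub>" by blast
    show "?h (x \<oplus>\<^bsub>part M q\<^esub> y) = \<zero>\<^bsub>?W\<^esub>"
      by (simp add: h(2)[OF x y] x0 y0)
  qed (rule V.zero_closed V.add.inv_closed V.a_closed V.smult_closed; assumption)+
next
  fix q q' m assume p: "q' - q \<in> Qp" and m: "m \<in> global_support K Qp \<tau> M q"
  then have mc: "m \<in> carrier (part M q)" unfolding global_support_iff by blast
  show "smap M q q' m \<in> global_support K Qp \<tau> M q'"
    unfolding global_support_iff
  proof (intro conjI allI impI smap_closed[OF p mc])
    fix \<tau>' assume \<tau>': "face Qp \<tau>' \<and> \<not> \<tau>' \<subseteq> \<tau>"
    then obtain t where t: "t \<in> \<tau>'" "smap M q (q + t) m = \<zero>\<^bsub>part M (q + t)\<^esub>"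
      using m unfolding global_support_iff by blast
    have tQ: "q' + t - q' \<in> Qp" "q + t - q \<in> Qp" "q' + t - (q + t) \<in> Qp"
      using t(1) \<tau>' p by (auto simp: face_def)
    have "smap M q' (q' + t) (smap M q q' m) = smap M (q + t) (q' + t) (smap M q (q + t) m)"
      using smap_smap[OF p tQ(1) mc] smap_smap[OF tQ(2,3) mc] by simp
    also have "\<dots> = \<zero>\<^bsub>part M (q' + t)\<^esub>" unfolding t(2) by (rule smap_zero[OF tQ(3)])
    finally show "\<exists>t\<in>\<tau>'. smap M q' (q' + t) (smap M q q' m) = \<zero>\<^bsub>part M (q' + t)\<^esub>"
      using t(1) by blast
  qed
qed

text \<open>
  The graded submodule generated by \<open>x\<close> in degree \<open>q\<close>.
\<close>

definition cyclic :: "'q \<Rightarrow> 'v \<Rightarrow> 'q \<Rightarrow> 'v set" where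
  "cyclic q x q' = (if q' - q \<in> Qp then {c \<odot>\<^bsub>part M q'\<^esub> smap M q q' x | c. c \<in> carrier K}
     else {\<zero>\<^bsub>part M q'\<^esub>})"

lemma cyclicI:
  "q' - q \<in> Qp \<Longrightarrow> c \<in> carrier K \<Longrightarrow> c \<odot>\<^bsub>part M q'\<^esub> smap M q q' x \<in> cyclic q x q'"
  by (auto simp: cyclic_def)

lemma cyclicE:
  assumes "v \<in> cyclic q x q'" "q' - q \<in> Qp"
  obtains c where "c \<in> carrier K" "v = c \<odot>\<^bsub>part M q'\<^esub> smap M q q' x"
  using assms by (auto simp: cyclic_def)

lemma cyclic_submodule:
  assumes x: "x \<in> carrier (part M q)" shows "is_qsubmodule K Qp M (cyclic q x)"
  unfolding is_qsubmodule_def qle_def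
proof (intro conjI allI impI funcsetI)
  interpret K: cring K by (rule cring_K)
  fix q'
  interpret V: module K "part M q'" by (rule module_part)
  show "submodule (cyclic q x q') K (part M q')"
  proof (cases "q' - q \<in> Qp")
    case True
    note y = smap_closed[OF True x]
    note c = cyclicI[OF True]
    show ?thesis
    proof (rule V.submoduleI)
      show "cyclic q x q' \<subseteq> carrier (part M q')" by (auto elim!: cyclicE[OF _ True] intro: y)
      show "\<zero>\<^bsub>part M q'\<^esub> \<in> cyclic q x q'" using c[OF K.zero_closed, of x] y by simp
      fix v assume "v \<in> cyclic q x q'"
      then obtain c1 where v: "c1 \<in> carrier K" "v = c1 \<odot>\<^bsub>part M q'\<^esub> smap M q q' x"
        using True by (rule cyclicE)
      show "\<ominus>\<^bsub>part M q'\<^esub> v \<in> cyclic q x q'"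
        using c[OF K.a_inv_closed[OF v(1)], of x] by (simp add: v V.smult_l_minus y)
      show "a \<odot>\<^bsub>part M q'\<^esub> v \<in> cyclic q x q'" if "a \<in> carrier K" for a
        using c[OF K.m_closed[OF that v(1)], of x] by (simp add: v that V.smult_assoc1 y)
      fix w assume "w \<in> cyclic q x q'"
      then obtain c2 where w: "c2 \<in> carrier K" "w = c2 \<odot>\<^bsub>part M q'\<^esub> smap M q q' x"
        using True by (rule cyclicE)
      show "v \<oplus>\<^bsub>part M q'\<^esub> w \<in> cyclic q x q'"
        using c[OF K.a_closed[OF v(1) w(1)], of x] by (simp add: v w V.smult_l_distr y)
    qed
  next
    case False
    then have "cyclic q x q' = {\<zero>\<^bsub>part M q'\<^esub>}" by (simp add: cyclic_def)
    moreover have "submodule {\<zero>\<^bsub>part M q'\<^esub>} K (part M q')"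
      by (rule V.submoduleI) simp_all
    ultimately show ?thesis by simp
  qed
next
  fix q' q'' v assume p: "q'' - q' \<in> Qp" and v: "v \<in> cyclic q x q'"
  interpret V: module K "part M q''" by (rule module_part)
  show "smap M q' q'' v \<in> cyclic q x q''"
  proof (cases "q' - q \<in> Qp")
    case True
    with v obtain c where c: "c \<in> carrier K" "v = c \<odot>\<^bsub>part M q'\<^esub> smap M q q' x"
      by (rule cyclicE)
    have qq: "q'' - q \<in> Qp" using Qp_add[OF p True] by simp
    have "smap M q' q'' v = c \<odot>\<^bsub>part M q''\<^esub> smap M q q'' x"
      by (simp only: c(2) linear_mapsD(3)[OF smap_linear[OF p] c(1) smap_closed[OF True x]]
        smap_smap[OF True p x])
    then show ?thesis by (simp only: cyclicI[OF qq c(1)])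
  next
    case False
    then have "smap M q' q'' v = \<zero>\<^bsub>part M q''\<^esub>" using v smap_zero[OF p] by (simp add: cyclic_def)
    moreover have "\<zero>\<^bsub>part M q''\<^esub> \<in> cyclic q x q''"
    proof (cases "q'' - q \<in> Qp")
      case True
      show ?thesis
        using cyclicI[OF True V.R.zero_closed, of x] smap_closed[OF True x] by simp
    qed (simp add: cyclic_def)
    ultimately show ?thesis by simp
  qed
qed

lemma cyclic_self: assumes "x \<in> carrier (part M q)" shows "x \<in> cyclic q x q"
proof -
  interpret V: module K "part M q" by (rule module_part)
  show ?thesis using cyclicI[of q q "\<one>\<^bsub>K\<^esub>" x] Qp_zero assms by (simp add: smap_id)
qed

text \<open>
  Essentiality, applied to the submodule generated by \<open>x\<close>, only gives \<open>c \<odot> smap M q q' x \<in> G q'\<close> for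
  some scalar \<open>c \<noteq> \<zero>\<close>; over a field the scalar can be divided out.
\<close>

lemma essential_meets_multiples:
  assumes ess: "essential_qsubmodule K Qp M G" and x: "x \<in> carrier (part M q)" "x \<noteq> \<zero>\<^bsub>part M q\<^esub>"
  obtains q' where "q' - q \<in> Qp" "smap M q q' x \<in> G q'" "smap M q q' x \<noteq> \<zero>\<^bsub>part M q'\<^esub>"
proof -
  interpret K: field K by (rule field_K)
  have "cyclic q x q \<noteq> {\<zero>\<^bsub>part M q\<^esub>}" using cyclic_self[OF x(1)] x(2) by blast
  then obtain q' where "cyclic q x q' \<inter> G q' \<noteq> {\<zero>\<^bsub>part M q'\<^esub>}"
    using ess cyclic_submodule[OF x(1)] unfolding essential_qsubmodule_def by blast
  moreover
  interpret V: module K "part M q'" by (rule module_part)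
  have G: "submodule (G q') K (part M q')"
    using ess unfolding essential_qsubmodule_def is_qsubmodule_def by blast
  have "submodule (cyclic q x q') K (part M q')"
    using cyclic_submodule[OF x(1)] unfolding is_qsubmodule_def by blast
  then have "\<zero>\<^bsub>part M q'\<^esub> \<in> cyclic q x q' \<inter> G q'"
    using G subgroup.one_closed[OF submodule.axioms(1)] by fastforce
  ultimately obtain v where v: "v \<in> cyclic q x q'" "v \<in> G q'" "v \<noteq> \<zero>\<^bsub>part M q'\<^esub>" by blast
  then have p: "q' - q \<in> Qp" by (auto simp: cyclic_def split: if_splits)
  from v(1) p obtain c where c: "c \<in> carrier K" "v = c \<odot>\<^bsub>part M q'\<^esub> smap M q q' x"
    by (rule cyclicE)
  note y = smap_closed[OF p x(1)]
  have "c \<noteq> \<zero>\<^bsub>K\<^esub>" using c v y by auto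
  then have cu: "c \<in> Units K" using c K.field_Units by blast
  have "inv\<^bsub>K\<^esub> c \<odot>\<^bsub>part M q'\<^esub> v = smap M q q' x"
    using cu y by (simp add: c(2) V.smult_assoc1[symmetric] K.Units_closed)
  moreover have "inv\<^bsub>K\<^esub> c \<odot>\<^bsub>part M q'\<^esub> v \<in> G q'"
    using V.submoduleE(4)[OF G] v(2) cu by simp
  moreover have "smap M q q' x \<noteq> \<zero>\<^bsub>part M q'\<^esub>" using v(3) c by auto
  ultimately show ?thesis using that[OF p] by simp
qed

end

section \<open>Coprimary modules\<close>

theorem theorem5p35:
  fixes K :: "'k ring"
    and Qp :: "'q::ab_group_add set"
    and \<tau> :: "'q set"
    and M :: "('q, 'k, 'v) qmod"
  assumes "field K"
    and "partially_ordered_group Qp"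
    and "polyhedral Qp"
    and "closed_pogroup Qp"
    and "face Qp \<tau>"
    and "is_qmodule K Qp M"
  shows "coprimary_module K Qp \<tau> M \<longleftrightarrow>
    (\<forall>q. \<forall>y\<in>carrier (part M q). y \<noteq> \<zero>\<^bsub>part M q\<^esub> \<longrightarrow>
       (\<exists>q' y'. coprimary_element Qp \<tau> M q' y' \<and> divides Qp M q y q' y'))"
proof -
  have Qp: "add_submonoid Qp" using assms(2) by (simp add: partially_ordered_group_def)
  interpret M: graded_module K Qp M by (rule graded_module.intro[OF assms(1) Qp assms(6)])
  interpret M: localized_module K Qp M \<tau> by (rule M.localized_module[OF assms(5)])
  let ?L = "localization K Qp \<tau> M" and ?loc = "loc_map K Qp \<tau> M"
  interpret L: graded_module K Qp ?L by (rule graded_module.intro[OF assms(1) Qp M.qmodule_L])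
  have inj_iff: "inj_on (?loc q) (carrier (part M q)) \<longleftrightarrow>
      (\<forall>m\<in>carrier (part M q). m \<noteq> \<zero>\<^bsub>part M q\<^esub> \<longrightarrow> persistent \<tau> M q m)" for q
    unfolding linear_maps_inj_iff[OF M.module_part M.module_L M.loc_map_linear] persistent_def
    using M.loc_map_zero_iff by blast
  have step: "q + t - q \<in> Qp" if "t \<in> \<tau>'" "face Qp \<tau>'" for q t \<tau>'
    using that by (auto simp: face_def)
  have loc_zero: "?loc q \<zero>\<^bsub>part M q\<^esub> = \<zero>\<^bsub>part ?L q\<^esub>" for q
    by (rule linear_maps_zero[OF M.module_part M.module_L M.loc_map_linear])
  show ?thesis
  proof (intro iffI allI ballI impI)
    fix q y assume cop: "coprimary_module K Qp \<tau> M"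
      and y: "y \<in> carrier (part M q)" "y \<noteq> \<zero>\<^bsub>part M q\<^esub>"
    have inj: "\<And>q. inj_on (?loc q) (carrier (part M q))"
      and ess: "essential_qsubmodule K Qp ?L (global_support K Qp \<tau> ?L)"
      using cop by (auto simp: coprimary_module_def)
    have inj0: "m = \<zero>\<^bsub>part M q\<^esub>" if "m \<in> carrier (part M q)" "?loc q m = \<zero>\<^bsub>part ?L q\<^esub>" for q m
      using inj that unfolding linear_maps_inj_iff[OF M.module_part M.module_L M.loc_map_linear]
      by blast
    have "?loc q y \<noteq> \<zero>\<^bsub>part ?L q\<^esub>" using inj0 y by blast
    then obtain q' where p: "q' - q \<in> Qp"
      and supp: "smap ?L q q' (?loc q y) \<in> global_support K Qp \<tau> ?L q'"
      and nz: "smap ?L q q' (?loc q y) \<noteq> \<zero>\<^bsub>part ?L q'\<^esub>"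
      by (rule L.essential_meets_multiples[OF ess linear_mapsD(1)[OF M.loc_map_linear y(1)]])
    define y' where "y' = smap M q q' y"
    have y': "y' \<in> carrier (part M q')" unfolding y'_def by (rule M.smap_closed[OF p y(1)])
    note nat = M.loc_map_natural[OF p y(1), folded y'_def]
    have "y' \<noteq> \<zero>\<^bsub>part M q'\<^esub>"
      using nz loc_zero[of q'] unfolding nat by auto
    then have pers: "persistent \<tau> M q' y'" using inj_iff inj y' by blast
    \<comment> \<open>Being in the global support descends from \<open>?loc q' y'\<close> to \<open>y'\<close> by naturality and injectivity.\<close>
    have killed: "\<exists>t\<in>\<tau>'. smap M q' (q' + t) y' = \<zero>\<^bsub>part M (q' + t)\<^esub>"
      if \<tau>': "face Qp \<tau>'" "\<not> \<tau>' \<subseteq> \<tau>" for \<tau>'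
    proof -
      obtain t where t: "t \<in> \<tau>'" "smap ?L q' (q' + t) (?loc q' y') = \<zero>\<^bsub>part ?L (q' + t)\<^esub>"
        using supp \<tau>' unfolding nat L.global_support_iff by blast
      note s = step[OF t(1) \<tau>'(1), of q']
      have "smap M q' (q' + t) y' = \<zero>\<^bsub>part M (q' + t)\<^esub>"
        by (rule inj0[OF M.smap_closed[OF s y']]) (simp only: M.loc_map_natural[OF s y', symmetric] t(2))
      then show ?thesis using t(1) by blast
    qed
    have "transient Qp \<tau> M q' y'"
      unfolding transient_def Let_def
    proof
      fix f assume f: "f \<in> Qp - \<tau>"
      \<comment> \<open>The face generated by \<open>f\<close> is not inside \<open>\<tau>\<close>, so one of its elements \<open>t\<close> kills \<open>y'\<close>.\<close>
      let ?S = "{x \<in> Qp. \<exists>l::nat. (\<Sum>i<l. f) - x \<in> Qp}"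
      have "(\<Sum>i<1::nat. f) - f \<in> Qp" using M.Qp_zero by simp
      then have "f \<in> ?S" using f by blast
      then have "\<not> ?S \<subseteq> \<tau>" using f by blast
      moreover have S: "face Qp ?S" using face_generated_by_element[OF Qp] f by blast
      ultimately obtain t where t: "t \<in> ?S" "smap M q' (q' + t) y' = \<zero>\<^bsub>part M (q' + t)\<^esub>"
        using killed by blast
      then obtain l0 :: nat where l0: "(\<Sum>i<l0. f) - t \<in> Qp" by blast
      \<comment> \<open>All multiples of \<open>f\<close> from \<open>l0 \<cdot> f\<close> on lie above \<open>t\<close>.\<close>
      have "smap M q' (q' + (\<Sum>i<l. f)) y' = \<zero>\<^bsub>part M (q' + (\<Sum>i<l. f))\<^esub>" if "l0 \<le> l" for l
      proof -
        define k where "k = l - l0"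
        have k: "l = k + l0" using that by (simp add: k_def)
        have "(\<Sum>i<k. f) \<in> Qp" using sum_const_mem[OF Qp] f by blast
        from M.Qp_add[OF this l0] have lt: "q' + (\<Sum>i<l. f) - (q' + t) \<in> Qp"
          by (simp only: k sum_const_lessThan_add add_diff_eq add_diff_cancel_left)
        show ?thesis
          using M.smap_smap[OF step[OF t(1) S] lt y'] M.smap_zero[OF lt] by (simp only: t(2))
      qed
      then show "\<exists>l0::nat. \<forall>l\<ge>l0. smap M q' (q' + (\<Sum>i<l. f)) y' = \<zero>\<^bsub>part M (q' + (\<Sum>i<l. f))\<^esub>"
        by (intro exI[of _ l0] allI impI)
    qed
    then have "coprimary_element Qp \<tau> M q' y' \<and> divides Qp M q y q' y'"
      using y' pers p by (simp add: coprimary_element_def divides_def qle_def y'_def)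
    then show "\<exists>q' y'. coprimary_element Qp \<tau> M q' y' \<and> divides Qp M q y q' y'" by blast
  next
    assume "\<forall>q. \<forall>y\<in>carrier (part M q). y \<noteq> \<zero>\<^bsub>part M q\<^esub> \<longrightarrow>
       (\<exists>q' y'. coprimary_element Qp \<tau> M q' y' \<and> divides Qp M q y q' y')"
    then have div: "\<exists>q'. q' - q \<in> Qp \<and> coprimary_element Qp \<tau> M q' (smap M q q' y)"
      if "y \<in> carrier (part M q)" "y \<noteq> \<zero>\<^bsub>part M q\<^esub>" for q y
      using that unfolding divides_def qle_def by blast
    have pers: "persistent \<tau> M q y"
      if y: "y \<in> carrier (part M q)" and nz: "y \<noteq> \<zero>\<^bsub>part M q\<^esub>" for q y
      unfolding persistent_def
    proof (intro ballI notI)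
      fix t assume t: "t \<in> \<tau>" and z: "smap M q (q + t) y = \<zero>\<^bsub>part M (q + t)\<^esub>"
      obtain q' where p: "q' - q \<in> Qp" and c: "coprimary_element Qp \<tau> M q' (smap M q q' y)"
        using div[OF y nz] by blast
      have s: "q + t - q \<in> Qp" "q' + t - q' \<in> Qp" using step[OF t assms(5)] by blast+
      have r: "q' + t - (q + t) \<in> Qp" using p by simp
      \<comment> \<open>A \<open>t \<in> \<tau>\<close> that kills \<open>y\<close> would also kill the persistent element that \<open>y\<close> divides.\<close>
      have "smap M q' (q' + t) (smap M q q' y) = \<zero>\<^bsub>part M (q' + t)\<^esub>"
        unfolding M.smap_smap[OF p s(2) y] M.smap_smap[OF s(1) r y, symmetric] z by (rule M.smap_zero[OF r])
      then show False using c t unfolding coprimary_element_def persistent_def by blast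
    qed
    have ess: "\<exists>q. N q \<inter> global_support K Qp \<tau> ?L q \<noteq> {\<zero>\<^bsub>part ?L q\<^esub>}"
      if N: "is_qsubmodule K Qp ?L N" and nz: "N q \<noteq> {\<zero>\<^bsub>part ?L q\<^esub>}" for N q
    proof -
      have Nsub: "submodule (N q) K (part ?L q)" for q using N by (simp add: is_qsubmodule_def)
      have Nmap: "smap ?L q q' x \<in> N q'" if "q' - q \<in> Qp" "x \<in> N q" for q q' x
        using N that unfolding is_qsubmodule_def qle_def by blast
      interpret Lq: module K "part ?L q" by (rule M.module_L)
      have "\<zero>\<^bsub>part ?L q\<^esub> \<in> N q" using subgroup.one_closed[OF submodule.axioms(1)[OF Nsub, of q]] by simp
      then obtain l where l: "l \<in> N q" "l \<noteq> \<zero>\<^bsub>part ?L q\<^esub>" using nz by blast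
      have lc: "l \<in> carrier (part ?L q)" using Lq.submoduleE(1)[OF Nsub] l(1) by blast
      obtain t m where t: "t \<in> \<tau>" and m: "m \<in> carrier (part M (q + t))"
        and lm: "smap ?L q (q + t) l = ?loc (q + t) m"
        by (rule M.L_clear_denominator[OF lc])
      have "m \<noteq> \<zero>\<^bsub>part M (q + t)\<^esub>"
        using M.smap_L_inj_along[OF lc t] l(2) loc_zero[of "q + t"] unfolding lm by auto
      then obtain q' where p: "q' - (q + t) \<in> Qp"
        and c: "coprimary_element Qp \<tau> M q' (smap M (q + t) q' m)"
        using div[OF m] by blast
      define y where "y = smap M (q + t) q' m"
      have y: "y \<in> carrier (part M q')" and yp: "persistent \<tau> M q' y" and yt: "transient Qp \<tau> M q' y"
        using c unfolding coprimary_element_def y_def by blast+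
      have "?loc q' y \<in> N q'"
        using Nmap[OF p Nmap[OF step[OF t assms(5)] l(1)]]
        unfolding lm M.loc_map_natural[OF p m] y_def .
      moreover have "?loc q' y \<noteq> \<zero>\<^bsub>part ?L q'\<^esub>"
        using yp unfolding M.loc_map_zero_iff[OF y] persistent_def by blast
      moreover have "?loc q' y \<in> global_support K Qp \<tau> ?L q'"
        unfolding L.global_support_iff
      proof (intro conjI allI impI linear_mapsD(1)[OF M.loc_map_linear y])
        fix \<tau>' assume \<tau>': "face Qp \<tau>' \<and> \<not> \<tau>' \<subseteq> \<tau>"
        then obtain f where f: "f \<in> \<tau>'" "f \<notin> \<tau>" by blast
        then have "f \<in> Qp - \<tau>" using \<tau>' by (auto simp: face_def)
        then obtain k :: nat where k: "smap M q' (q' + (\<Sum>i<k. f)) y = \<zero>\<^bsub>part M (q' + (\<Sum>i<k. f))\<^esub>"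
          using yt unfolding transient_def Let_def by blast
        have kf: "(\<Sum>i<k. f) \<in> \<tau>'" using sum_const_mem[of \<tau>' f] \<tau>' f(1) by (simp add: face_def)
        have "smap ?L q' (q' + (\<Sum>i<k. f)) (?loc q' y) = \<zero>\<^bsub>part ?L (q' + (\<Sum>i<k. f))\<^esub>"
          unfolding M.loc_map_natural[OF step[OF kf conjunct1[OF \<tau>']] y] k by (rule loc_zero)
        then show "\<exists>t\<in>\<tau>'. smap ?L q' (q' + t) (?loc q' y) = \<zero>\<^bsub>part ?L (q' + t)\<^esub>" using kf by blast
      qed
      ultimately show ?thesis by blast
    qed
    show "coprimary_module K Qp \<tau> M"
      unfolding coprimary_module_def essential_qsubmodule_def
    proof (intro conjI allI impI; (elim conjE exE)?)
      show "inj_on (?loc q) (carrier (part M q))" for q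
        unfolding inj_iff using pers by blast
      show "is_qsubmodule K Qp ?L (global_support K Qp \<tau> ?L)"
        by (rule L.global_support_submodule)
    qed (rule ess)
  qed
qed

end
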